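(* Let $1<p<\infty$, let $X=\ell^p(\mathbb N)$ (complex scalars), let $(\lambda_n)_{n\ge1}$ be a sequence of complex numbers with $\sup_{n\ge1}|\lambda_n|<\infty$, and let $D=\operatorname{diag}(\lambda_1,\lambda_2,\lambda_3,\dots)\in\mathcal B(X)$. Then: (i) $D$ is numerically hypercyclic if and only if $G_D\neq\varnothing$; (ii) $D$ is topologically numerically transitive if and only if $G_D$ is dense in $\Delta$.
   Context: $\Delta:=\{a=(a_n)_{n\ge1}\in\ell^1: a_n\ge0,\ \sum_{n\ge1}a_n=1\}$, with the $\ell^1$-norm topology. For $a\in\Delta$, $\mathcal O_D(a):=\{1\}\cup\{\sum_{n\ge1}a_n\lambda_n^m: m\ge1\}$, and $G_D:=\{a\in\Delta:\mathcal O_D(a)\text{ is dense in }\mathbb C\}$. For a complex Banach space $X$ with unit spheres $S_X$, $S_{X^*}$, $\Pi(X):=\{(x,x^* )\in S_X\times S_{X^*}:x^*(x)=1\}$ with the topology induced by the norm $\max\{\|x\|,\|x^*\|\}$. An operator $T\in\mathcal B(X)$ is numerically hypercyclic if there is $(x,x^* )\in\Pi(X)$ such that $\{x^*(T^nx):n\ge 0\}$ is dense in $\mathbb C$. It is topologically numerically transitive if for every nonempty open $U\subset\Pi(X)$ and nonempty open $V\subset\mathbb C$ there exist $n\ge 0$ and $(x,x^* )\in U$ with $x^*(T^nx)\in V$. *)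

theory Defs
  imports "HOL-Analysis.Analysis" "HOL-Library.Function_Algebras"
begin

section \<open>Complex Banach spaces with an explicit carrier\<close>

text \<open>
  The exponent of \<open>\<ell>\<^sup>p\<close> is a variable, so the spaces are carriers inside an ambient complex
  vector space rather than types of class \<^class>\<open>banach\<close>.
\<close>

record 'v complex_normed =
  vecs :: "'v set"
  scl :: "complex \<Rightarrow> 'v \<Rightarrow> 'v"
  nrm :: "'v \<Rightarrow> real"

text \<open>
  \<^locale>\<open>Metric_space\<close> asks for nonnegativity and symmetry of the distance on the whole type, and
  the norms below are meaningful on the carrier only; hence the value 0 off the carrier.
\<close>

definition dist_on :: "'a set \<Rightarrow> ('a \<Rightarrow> 'a \<Rightarrow> real) \<Rightarrow> 'a \<Rightarrow> 'a \<Rightarrow> real" where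
  "dist_on M d = (\<lambda>x y. if x \<in> M \<and> y \<in> M then d x y else 0)"

definition complex_normed_space :: "'v::ab_group_add complex_normed \<Rightarrow> bool" where
  "complex_normed_space X \<longleftrightarrow>
     vector_space (scl X) \<and> module.subspace (scl X) (vecs X) \<and>
     (\<forall>x\<in>vecs X. 0 \<le> nrm X x \<and> (nrm X x = 0 \<longleftrightarrow> x = 0)) \<and>
     (\<forall>c. \<forall>x\<in>vecs X. nrm X (scl X c x) = cmod c * nrm X x) \<and>
     (\<forall>x\<in>vecs X. \<forall>y\<in>vecs X. nrm X (x + y) \<le> nrm X x + nrm X y)"

definition complex_banach_space :: "'v::ab_group_add complex_normed \<Rightarrow> bool" where
  "complex_banach_space X \<longleftrightarrow> complex_normed_space X \<and>
     Metric_space.mcomplete (vecs X) (dist_on (vecs X) (\<lambda>x y. nrm X (x - y)))"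

definition bounded_operators :: "'v::ab_group_add complex_normed \<Rightarrow> ('v \<Rightarrow> 'v) set" where
  "bounded_operators X =
     {T. (\<forall>x\<in>vecs X. T x \<in> vecs X) \<and>
         (\<forall>x\<in>vecs X. \<forall>y\<in>vecs X. T (x + y) = T x + T y) \<and>
         (\<forall>c. \<forall>x\<in>vecs X. T (scl X c x) = scl X c (T x)) \<and>
         (\<exists>C. \<forall>x\<in>vecs X. nrm X (T x) \<le> C * nrm X x)}"

text \<open>Functionals vanish off the carrier, so that each one is a single function on the type.\<close>

definition dual_space :: "'v::ab_group_add complex_normed \<Rightarrow> ('v \<Rightarrow> complex) set" where
  "dual_space X =
     {f. (\<forall>x\<in>vecs X. \<forall>y\<in>vecs X. f (x + y) = f x + f y) \<and>
         (\<forall>c. \<forall>x\<in>vecs X. f (scl X c x) = c * f x) \<and>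
         (\<exists>C. \<forall>x\<in>vecs X. cmod (f x) \<le> C * nrm X x) \<and>
         (\<forall>x. x \<notin> vecs X \<longrightarrow> f x = 0)}"

definition dual_norm :: "'v::ab_group_add complex_normed \<Rightarrow> ('v \<Rightarrow> complex) \<Rightarrow> real" where
  "dual_norm X f = (SUP x\<in>{x\<in>vecs X. nrm X x \<le> 1}. cmod (f x))"


section \<open>Numerical hypercyclicity and numerical transitivity\<close>

definition Pi_set :: "'v::ab_group_add complex_normed \<Rightarrow> ('v \<times> ('v \<Rightarrow> complex)) set" where
  "Pi_set X = {(x, f). x \<in> vecs X \<and> nrm X x = 1 \<and> f \<in> dual_space X \<and> dual_norm X f = 1 \<and> f x = 1}"

definition Pi_dist ::
    "'v::ab_group_add complex_normed \<Rightarrow> 'v \<times> ('v \<Rightarrow> complex) \<Rightarrow> 'v \<times> ('v \<Rightarrow> complex) \<Rightarrow> real" where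
  "Pi_dist X u v = max (nrm X (fst u - fst v)) (dual_norm X (\<lambda>x. snd u x - snd v x))"

definition Pi_topology ::
    "'v::ab_group_add complex_normed \<Rightarrow> ('v \<times> ('v \<Rightarrow> complex)) topology" where
  "Pi_topology X = Metric_space.mtopology (Pi_set X) (dist_on (Pi_set X) (Pi_dist X))"

definition numerically_hypercyclic ::
    "'v::ab_group_add complex_normed \<Rightarrow> ('v \<Rightarrow> 'v) \<Rightarrow> bool" where
  "numerically_hypercyclic X T \<longleftrightarrow> T \<in> bounded_operators X \<and>
     (\<exists>(x, f)\<in>Pi_set X. closure {f ((T ^^ n) x) | n. True} = UNIV)"

definition topologically_numerically_transitive ::
    "'v::ab_group_add complex_normed \<Rightarrow> ('v \<Rightarrow> 'v) \<Rightarrow> bool" where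
  "topologically_numerically_transitive X T \<longleftrightarrow> T \<in> bounded_operators X \<and>
     (\<forall>U V. openin (Pi_topology X) U \<and> U \<noteq> {} \<and> open V \<and> V \<noteq> {} \<longrightarrow>
        (\<exists>n. \<exists>(x, f)\<in>U. f ((T ^^ n) x) \<in> V))"


section \<open>The sequence spaces and diagonal operators\<close>

text \<open>All sequences are indexed from 0 instead of 1.\<close>

definition ell :: "real \<Rightarrow> (nat \<Rightarrow> complex) complex_normed" where
  "ell p = \<lparr>vecs = {x. summable (\<lambda>n. cmod (x n) powr p)},
            scl = (\<lambda>c x n. c * x n),
            nrm = (\<lambda>x. (\<Sum>n. cmod (x n) powr p) powr (1 / p))\<rparr>"

definition diag_op :: "(nat \<Rightarrow> complex) \<Rightarrow> (nat \<Rightarrow> complex) \<Rightarrow> nat \<Rightarrow> complex" where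
  "diag_op lam x = (\<lambda>n. lam n * x n)"

definition Delta :: "(nat \<Rightarrow> real) set" where
  "Delta = {a. (\<forall>n. 0 \<le> a n) \<and> a sums 1}"

definition Delta_topology :: "(nat \<Rightarrow> real) topology" where
  "Delta_topology = Metric_space.mtopology Delta (dist_on Delta (\<lambda>a b. \<Sum>n. \<bar>a n - b n\<bar>))"

definition orbit_D :: "(nat \<Rightarrow> complex) \<Rightarrow> (nat \<Rightarrow> real) \<Rightarrow> complex set" where
  "orbit_D lam a = {1} \<union> {(\<Sum>n. of_real (a n) * lam n ^ m) | m::nat. m \<ge> 1}"

definition G_D :: "(nat \<Rightarrow> complex) \<Rightarrow> (nat \<Rightarrow> real) set" where
  "G_D lam = {a \<in> Delta. closure (orbit_D lam a) = UNIV}"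


section \<open>The definitions are well posed\<close>

lemma Metric_space_Delta: "Metric_space Delta (dist_on Delta (\<lambda>a b. \<Sum>n. \<bar>a n - b n\<bar>))"
proof -
  have s: "summable (\<lambda>n. \<bar>a n - b n\<bar>)" if "a \<in> Delta" "b \<in> Delta" for a b
  proof (rule summable_comparison_test[OF _ summable_add])
    show "summable a" "summable b"
      using that by (auto simp: Delta_def sums_iff)
    have "\<bar>a n - b n\<bar> \<le> a n + b n" for n
      using that by (auto simp: Delta_def abs_le_iff add_increasing add_increasing2 diff_le_eq)
    then show "\<exists>N. \<forall>n\<ge>N. norm \<bar>a n - b n\<bar> \<le> a n + b n" by simp
  qed
  show ?thesis
  proof
    fix a b c :: "nat \<Rightarrow> real"
    let ?d = "dist_on Delta (\<lambda>a b. \<Sum>n. \<bar>a n - b n\<bar>)"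
    show "0 \<le> ?d a b"
      using s by (auto simp: dist_on_def intro: suminf_nonneg)
    show "?d a b = ?d b a"
      by (simp add: dist_on_def abs_minus_commute)
    assume ab: "a \<in> Delta" "b \<in> Delta"
    show "?d a b = 0 \<longleftrightarrow> a = b"
      using ab s[OF ab] by (auto simp: dist_on_def suminf_eq_zero_iff)
    assume c: "c \<in> Delta"
    have "(\<Sum>n. \<bar>a n - c n\<bar>) \<le> (\<Sum>n. \<bar>a n - b n\<bar> + \<bar>b n - c n\<bar>)"
      using ab c by (intro suminf_le summable_add s) auto
    also have "\<dots> = (\<Sum>n. \<bar>a n - b n\<bar>) + (\<Sum>n. \<bar>b n - c n\<bar>)"
      using ab c by (intro suminf_add[symmetric] s)
    finally show "?d a c \<le> ?d a b + ?d b c"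
      using ab c by (simp add: dist_on_def)
  qed
qed

context
  fixes X :: "'v::ab_group_add complex_normed"
  assumes X: "complex_normed_space X"
begin

lemma vs: "vector_space (scl X)" and sub: "module.subspace (scl X) (vecs X)"
  using X by (auto simp: complex_normed_space_def)

lemma md: "module (scl X)"
  using vs by (simp add: module_iff_vector_space)

lemma cns_closed:
  "0 \<in> vecs X" "x \<in> vecs X \<Longrightarrow> y \<in> vecs X \<Longrightarrow> x + y \<in> vecs X"
  "x \<in> vecs X \<Longrightarrow> scl X c x \<in> vecs X"
  "x \<in> vecs X \<Longrightarrow> y \<in> vecs X \<Longrightarrow> x - y \<in> vecs X"
  using module.subspace_0[OF md sub] module.subspace_add[OF md sub]
    module.subspace_scale[OF md sub] module.subspace_diff[OF md sub] by auto

lemma cns_norm: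
  "x \<in> vecs X \<Longrightarrow> 0 \<le> nrm X x" "x \<in> vecs X \<Longrightarrow> nrm X x = 0 \<longleftrightarrow> x = 0"
  "x \<in> vecs X \<Longrightarrow> nrm X (scl X c x) = cmod c * nrm X x"
  "x \<in> vecs X \<Longrightarrow> y \<in> vecs X \<Longrightarrow> nrm X (x + y) \<le> nrm X x + nrm X y"
  using X by (auto simp: complex_normed_space_def)

lemma cns_norm_minus: 
  assumes "x \<in> vecs X" "y \<in> vecs X" shows "nrm X (x - y) = nrm X (y - x)"
proof -
  have "scl X (-1) (x - y) = y - x"
    using module.scale_minus_left[OF md, of 1 "x - y"] module.scale_one[OF md, of "x - y"] by simp
  then show ?thesis
    using cns_norm(3)[OF cns_closed(4)[OF assms], of "-1"] by simp
qed

lemma Metric_space_normed: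
  "Metric_space (vecs X) (dist_on (vecs X) (\<lambda>x y. nrm X (x - y)))"
proof
  fix x y z
  show "0 \<le> dist_on (vecs X) (\<lambda>x y. nrm X (x - y)) x y"
    by (auto simp: dist_on_def cns_norm cns_closed)
  show "dist_on (vecs X) (\<lambda>x y. nrm X (x - y)) x y = dist_on (vecs X) (\<lambda>x y. nrm X (x - y)) y x"
    by (auto simp: dist_on_def intro: cns_norm_minus)
  assume xy: "x \<in> vecs X" "y \<in> vecs X"
  then show "dist_on (vecs X) (\<lambda>x y. nrm X (x - y)) x y = 0 \<longleftrightarrow> x = y"
    by (auto simp: dist_on_def cns_norm cns_closed)
  assume z: "z \<in> vecs X"
  show "dist_on (vecs X) (\<lambda>x y. nrm X (x - y)) x z
    \<le> dist_on (vecs X) (\<lambda>x y. nrm X (x - y)) x y + dist_on (vecs X) (\<lambda>x y. nrm X (x - y)) y z"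
    using cns_norm(4)[of "x - y" "y - z"] xy z by (simp add: dist_on_def cns_closed)
qed

lemma dual_space_diff:
  assumes f: "f \<in> dual_space X" and g: "g \<in> dual_space X"
  shows "(\<lambda>x. f x - g x) \<in> dual_space X"
proof -
  obtain C D where "\<forall>x\<in>vecs X. cmod (f x) \<le> C * nrm X x" "\<forall>x\<in>vecs X. cmod (g x) \<le> D * nrm X x"
    using f g by (auto simp: dual_space_def)
  then have "\<forall>x\<in>vecs X. cmod (f x - g x) \<le> (C + D) * nrm X x"
    by (auto simp: algebra_simps intro: norm_triangle_le_diff add_mono)
  then have "\<exists>C. \<forall>x\<in>vecs X. cmod (f x - g x) \<le> C * nrm X x" ..
  then show ?thesis
    using f g by (simp add: dual_space_def algebra_simps)
qed

lemma dual_norm_bdd: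
  assumes "f \<in> dual_space X"
  shows "bdd_above ((\<lambda>x. cmod (f x)) ` {x\<in>vecs X. nrm X x \<le> 1})"
proof -
  obtain C where C: "\<forall>x\<in>vecs X. cmod (f x) \<le> C * nrm X x"
    using assms by (auto simp: dual_space_def)
  have "cmod (f x) \<le> \<bar>C\<bar>" if x: "x \<in> vecs X" "nrm X x \<le> 1" for x
  proof -
    have "cmod (f x) \<le> C * nrm X x" using C x by auto
    also have "\<dots> \<le> \<bar>C\<bar> * nrm X x" using cns_norm x by (intro mult_right_mono) auto
    also have "\<dots> \<le> \<bar>C\<bar> * 1" using x by (intro mult_left_mono) auto
    finally show ?thesis by simp
  qed
  then show ?thesis by (auto intro!: bdd_aboveI)
qed

lemma dual_norm_upper:
  assumes "f \<in> dual_space X" "x \<in> vecs X" "nrm X x \<le> 1"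
  shows "cmod (f x) \<le> dual_norm X f"
  unfolding dual_norm_def using assms by (intro cSUP_upper dual_norm_bdd) auto

lemma dual_norm_least:
  assumes "\<And>x. x \<in> vecs X \<Longrightarrow> nrm X x \<le> 1 \<Longrightarrow> cmod (f x) \<le> B"
  shows "dual_norm X f \<le> B"
proof -
  have "nrm X 0 = 0" using cns_norm(2) cns_closed by blast
  then have "{x\<in>vecs X. nrm X x \<le> 1} \<noteq> {}" using cns_closed(1) by force
  then show ?thesis
    unfolding dual_norm_def using assms by (intro cSUP_least) auto
qed

lemma dual_norm_nonneg: "f \<in> dual_space X \<Longrightarrow> 0 \<le> dual_norm X f"
  using dual_norm_upper[of f 0] cns_closed(1) cns_norm(2)[of 0]
  by (metis dual_norm_upper order_refl norm_ge_zero order_trans zero_le_one)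

lemma dual_norm_eq_0:
  assumes f: "f \<in> dual_space X" and 0: "dual_norm X f = 0"
  shows "f x = 0"
proof (cases "x \<in> vecs X \<and> x \<noteq> 0")
  case True
  define c where "c = complex_of_real (inverse (nrm X x))"
  have p: "nrm X x > 0" using True cns_norm(1,2) by force
  then have "nrm X (scl X c x) = 1"
    using True by (simp add: cns_norm(3) c_def norm_inverse)
  then have "cmod (f (scl X c x)) \<le> 0"
    using dual_norm_upper[OF f, of "scl X c x"] True 0 by (simp add: cns_closed)
  moreover have "f (scl X c x) = c * f x"
    using f True by (auto simp: dual_space_def)
  ultimately show ?thesis using p by (simp add: c_def)
next
  case False
  have "f (0 + 0) = f 0 + f 0"
    using f cns_closed(1) unfolding dual_space_def by blast
  then have "f 0 = 0" by simp
  then show ?thesis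
    using f False by (auto simp: dual_space_def)
qed

lemma Metric_space_Pi: "Metric_space (Pi_set X) (dist_on (Pi_set X) (Pi_dist X))"
proof -
  have aux: "x \<in> vecs X" "f \<in> dual_space X" if "(x, f) \<in> Pi_set X" for x f
    using that by (auto simp: Pi_set_def)
  show ?thesis
  proof
    fix u v w :: "'v \<times> ('v \<Rightarrow> complex)"
    obtain x f y g z h where [simp]: "u = (x, f)" "v = (y, g)" "w = (z, h)"
      by (cases u, cases v, cases w)
    show "0 \<le> dist_on (Pi_set X) (Pi_dist X) u v"
      using aux by (auto simp: dist_on_def Pi_dist_def le_max_iff_disj cns_norm cns_closed)
    have "dual_norm X (\<lambda>x. f x - g x) = dual_norm X (\<lambda>x. g x - f x)"
      by (simp add: dual_norm_def norm_minus_commute)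
    then show "dist_on (Pi_set X) (Pi_dist X) u v = dist_on (Pi_set X) (Pi_dist X) v u"
      using aux cns_norm_minus[of x y] by (auto simp: dist_on_def Pi_dist_def)
    assume u: "u \<in> Pi_set X" and v: "v \<in> Pi_set X"
    have dn0: "dual_norm X (\<lambda>x. 0) = 0"
      by (intro antisym dual_norm_least dual_norm_nonneg) (auto simp: dual_space_def intro!: exI[of _ 0])
    show "dist_on (Pi_set X) (Pi_dist X) u v = 0 \<longleftrightarrow> u = v"
    proof
      assume "dist_on (Pi_set X) (Pi_dist X) u v = 0"
      then have m: "max (nrm X (x - y)) (dual_norm X (\<lambda>x. f x - g x)) = 0"
        using u v by (simp add: dist_on_def Pi_dist_def)
      have "0 \<le> nrm X (x - y)" "0 \<le> dual_norm X (\<lambda>x. f x - g x)"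
        using u v aux by (auto intro!: cns_norm cns_closed dual_norm_nonneg dual_space_diff)
      then have "nrm X (x - y) = 0" "dual_norm X (\<lambda>x. f x - g x) = 0"
        using m by (auto simp: max_def split: if_splits)
      then have "x = y" "\<And>x. f x - g x = 0"
        using u v aux dual_norm_eq_0[OF dual_space_diff, of f g] cns_norm(2)[OF cns_closed(4), of x y]
        by auto
      then show "u = v" by auto
    next
      assume "u = v"
      then show "dist_on (Pi_set X) (Pi_dist X) u v = 0"
        using cns_norm(2)[OF cns_closed(1)] by (auto simp: dist_on_def Pi_dist_def dn0)
    qed
    assume w: "w \<in> Pi_set X"
    have 1: "nrm X (x - z) \<le> nrm X (x - y) + nrm X (y - z)"
      using u v w aux cns_norm(4)[of "x - y" "y - z"] by (auto simp: cns_closed)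
    have 2: "dual_norm X (\<lambda>x. f x - h x) \<le> dual_norm X (\<lambda>x. f x - g x) + dual_norm X (\<lambda>x. g x - h x)"
    proof (rule dual_norm_least)
      fix t assume t: "t \<in> vecs X" "nrm X t \<le> 1"
      have "cmod (f t - h t) \<le> cmod (f t - g t) + cmod (g t - h t)"
        using norm_triangle_ineq[of "f t - g t" "g t - h t"] by simp
      also have "\<dots> \<le> dual_norm X (\<lambda>x. f x - g x) + dual_norm X (\<lambda>x. g x - h x)"
        using u v w aux t dual_norm_upper[OF dual_space_diff, of f g t]
          dual_norm_upper[OF dual_space_diff, of g h t] by (auto intro!: add_mono)
      finally show "cmod (f t - h t) \<le> dual_norm X (\<lambda>x. f x - g x) + dual_norm X (\<lambda>x. g x - h x)" .
    qed
    show "dist_on (Pi_set X) (Pi_dist X) u w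
        \<le> dist_on (Pi_set X) (Pi_dist X) u v + dist_on (Pi_set X) (Pi_dist X) v w"
      using u v w 1 2 by (auto simp: dist_on_def Pi_dist_def)
  qed
qed

end

lemma powr_convex_ge0:
  fixes u v s t p :: real
  assumes "p \<ge> 1" "u \<ge> 0" "v \<ge> 0" "s \<ge> 0" "t \<ge> 0" "s + t = 1"
  shows "(s * u + t * v) powr p \<le> s * u powr p + t * v powr p"
proof -
  have le: "r powr p \<le> r" if "0 \<le> r" "r \<le> 1" for r :: real
    using powr_mono'[of 1 p r] that assms by (cases "r = 0") auto
  consider "u = 0" | "v = 0" | "u > 0" "v > 0" using assms by force
  then show ?thesis
  proof cases
    case 1
    then show ?thesis
      using assms le[of t] by (auto simp: powr_mult intro!: mult_right_mono)
  next
    case 2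
    then show ?thesis
      using assms le[of s] by (auto simp: powr_mult intro!: mult_right_mono)
  next
    case 3
    then have "((1 - t) * u + t * v) powr p \<le> (1 - t) * u powr p + t * v powr p"
      using convex_onD[OF powr_convex[OF assms(1)], of t u v] assms by simp
    moreover have "1 - t = s" using assms by simp
    ultimately show ?thesis by simp
  qed
qed

lemma ell_sel [simp]:
  "x \<in> vecs (ell p) \<longleftrightarrow> summable (\<lambda>n. cmod (x n) powr p)"
  "scl (ell p) c x = (\<lambda>n. c * x n)"
  "nrm (ell p) x = (\<Sum>n. cmod (x n) powr p) powr (1 / p)"
  by (simp_all add: ell_def)

lemma ell_norm_powr:
  assumes "1 < p" "x \<in> vecs (ell p)"
  shows "nrm (ell p) x powr p = (\<Sum>n. cmod (x n) powr p)"
  using assms by (simp add: powr_powr suminf_nonneg)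

lemma ell_norm_eq_0:
  assumes "1 < p" "x \<in> vecs (ell p)"
  shows "nrm (ell p) x = 0 \<longleftrightarrow> x = 0"
  using assms by (auto simp: suminf_eq_zero_iff fun_eq_iff)

lemma ell_norm_le:
  assumes p: "1 < p" and B: "B \<ge> 0" and le: "\<And>N. (\<Sum>n<N. cmod (x n) powr p) \<le> B powr p"
  shows "x \<in> vecs (ell p)" "nrm (ell p) x \<le> B"
proof -
  have s: "summable (\<lambda>n. cmod (x n) powr p)"
    by (rule summableI_nonneg_bounded[OF _ le]) simp
  then show "x \<in> vecs (ell p)" by simp
  have "(\<Sum>n. cmod (x n) powr p) powr (1 / p) \<le> (B powr p) powr (1 / p)"
    using p s by (intro powr_mono2 suminf_le_const le suminf_nonneg) auto
  then show "nrm (ell p) x \<le> B"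
    using p B by (simp add: powr_powr)
qed

lemma ell_norm_add:
  assumes p: "1 < p" and x: "x \<in> vecs (ell p)" and y: "y \<in> vecs (ell p)"
  shows "x + y \<in> vecs (ell p)" "nrm (ell p) (x + y) \<le> nrm (ell p) x + nrm (ell p) y"
proof -
  define A where "A = nrm (ell p) x"
  define B where "B = nrm (ell p) y"
  have AB: "A \<ge> 0" "B \<ge> 0" by (simp_all add: A_def B_def)
  have main: "(\<Sum>n<N. cmod ((x + y) n) powr p) \<le> (A + B) powr p" for N
  proof (cases "A = 0 \<or> B = 0")
    case True
    then have "x = 0 \<or> y = 0"
      using ell_norm_eq_0[OF p] x y by (auto simp: A_def B_def simp del: ell_sel)
    moreover have "(\<Sum>n<N. cmod (x n) powr p) \<le> A powr p" "(\<Sum>n<N. cmod (y n) powr p) \<le> B powr p"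
      using x y ell_norm_powr[OF p x] ell_norm_powr[OF p y]
      by (auto simp: A_def B_def intro!: sum_le_suminf simp del: ell_sel(3))
    moreover have "A = 0" if "x = 0" using that p by (simp add: A_def)
    moreover have "B = 0" if "y = 0" using that p by (simp add: B_def)
    ultimately show ?thesis by auto
  next
    case False
    then have P: "A > 0" "B > 0" using AB by auto
    define s t where "s = A / (A + B)" and "t = B / (A + B)"
    have st: "s \<ge> 0" "t \<ge> 0" "s + t = 1"
      using P by (auto simp: s_def t_def add_divide_distrib[symmetric])
    have pt: "cmod ((x + y) n) powr p \<le> (A + B) powr p *
        (s * (cmod (x n) powr p / A powr p) + t * (cmod (y n) powr p / B powr p))" for n
    proof -
      have "cmod ((x + y) n) powr p \<le> (cmod (x n) + cmod (y n)) powr p"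
        using p by (intro powr_mono2) (auto intro: norm_triangle_ineq)
      also have "cmod (x n) + cmod (y n) = (A + B) * (s * (cmod (x n) / A) + t * (cmod (y n) / B))"
      proof -
        have "(A + B) * (s * (cmod (x n) / A) + t * (cmod (y n) / B))
            = ((A + B) * s) / A * cmod (x n) + ((A + B) * t) / B * cmod (y n)"
          by (simp add: algebra_simps)
        moreover have "(A + B) * s = A" "(A + B) * t = B"
          using P by (auto simp: s_def t_def)
        ultimately show ?thesis using P by simp
      qed
      also have "\<dots> powr p = (A + B) powr p * (s * (cmod (x n) / A) + t * (cmod (y n) / B)) powr p"
        by (rule powr_mult)
      also have "\<dots> \<le> (A + B) powr p *
          (s * (cmod (x n) / A) powr p + t * (cmod (y n) / B) powr p)"
        using P st p by (intro mult_left_mono powr_convex_ge0) auto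
      finally show ?thesis using P by (simp add: powr_divide)
    qed
    have sx: "(\<Sum>n<N. cmod (x n) powr p) \<le> A powr p" and sy: "(\<Sum>n<N. cmod (y n) powr p) \<le> B powr p"
      using x y ell_norm_powr[OF p x] ell_norm_powr[OF p y]
      by (auto simp: A_def B_def intro!: sum_le_suminf simp del: ell_sel(3))
    have "(\<Sum>n<N. cmod ((x + y) n) powr p) \<le> (\<Sum>n<N. (A + B) powr p *
        (s * (cmod (x n) powr p / A powr p) + t * (cmod (y n) powr p / B powr p)))"
      by (intro sum_mono pt)
    also have "\<dots> = (A + B) powr p * (s * ((\<Sum>n<N. cmod (x n) powr p) / A powr p)
        + t * ((\<Sum>n<N. cmod (y n) powr p) / B powr p))"
      unfolding sum_distrib_left[symmetric] sum.distrib sum_divide_distrib ..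
    also have "\<dots> \<le> (A + B) powr p * (s * 1 + t * 1)"
      using P st sx sy by (intro mult_left_mono add_mono) (auto simp: divide_le_eq)
    finally show ?thesis using st by simp
  qed
  show "x + y \<in> vecs (ell p)"
    by (rule ell_norm_le(1)[OF p _ main]) (use AB in simp)
  show "nrm (ell p) (x + y) \<le> nrm (ell p) x + nrm (ell p) y"
    using ell_norm_le(2)[OF p _ main] AB unfolding A_def B_def by (meson add_nonneg_nonneg)
qed

lemma ell_normed:
  assumes p: "1 < p"
  shows "complex_normed_space (ell p)"
proof -
  have v: "vector_space (scl (ell p))"
    by unfold_locales (auto simp: fun_eq_iff algebra_simps)
  have sc: "scl (ell p) c x \<in> vecs (ell p)" "nrm (ell p) (scl (ell p) c x) = cmod c * nrm (ell p) x"
    if "x \<in> vecs (ell p)" for c x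
    using that p by (auto simp: norm_mult powr_mult suminf_mult suminf_nonneg powr_powr intro: summable_mult)
  have "module.subspace (scl (ell p)) (vecs (ell p))"
    using v sc(1) ell_norm_add(1)[OF p]
    by (subst module.subspace_def) (auto simp: module_iff_vector_space simp del: ell_sel(2))
  moreover have "0 \<le> nrm (ell p) x" for x by simp
  ultimately show ?thesis
    unfolding complex_normed_space_def
    using v sc(2) ell_norm_eq_0[OF p] ell_norm_add(2)[OF p] by blast
qed

lemma ell_banach:
  assumes p: "1 < p"
  shows "complex_banach_space (ell p)"
proof -
  let ?d = "dist_on (vecs (ell p)) (\<lambda>x y. nrm (ell p) (x - y))"
  interpret M: Metric_space "vecs (ell p)" ?d
    by (rule Metric_space_normed[OF ell_normed[OF p]])
  note closed = cns_closed[OF ell_normed[OF p]]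
  have part: "(\<Sum>n<N. cmod (x n) powr p) \<le> B powr p"
    if "x \<in> vecs (ell p)" "nrm (ell p) x \<le> B" for x B N
  proof -
    have "(\<Sum>n<N. cmod (x n) powr p) \<le> nrm (ell p) x powr p"
      using that(1) unfolding ell_norm_powr[OF p that(1)] by (intro sum_le_suminf) auto
    also have "\<dots> \<le> B powr p"
      using that p by (intro powr_mono2) auto
    finally show ?thesis .
  qed
  have coord: "cmod (x n) \<le> nrm (ell p) x" if "x \<in> vecs (ell p)" for x n
  proof -
    have "cmod (x n) powr p \<le> (\<Sum>n<Suc n. cmod (x n) powr p)"
      by (simp add: sum_nonneg)
    also have "\<dots> \<le> nrm (ell p) x powr p" by (rule part[OF that order_refl])
    finally have le: "cmod (x n) powr p \<le> nrm (ell p) x powr p" .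
    have "0 \<le> nrm (ell p) x" by simp
    then have "nrm (ell p) x powr p < cmod (x n) powr p" if "nrm (ell p) x < cmod (x n)"
      using p that by (intro powr_less_mono2) auto
    then show ?thesis using le by (meson not_le)
  qed
  have "\<exists>x. limitin M.mtopology \<sigma> x sequentially" if \<sigma>: "M.MCauchy \<sigma>" for \<sigma>
  proof -
    have inX: "\<sigma> k \<in> vecs (ell p)" for k using \<sigma> by (auto simp: M.MCauchy_def simp del: ell_sel)
    have C: "\<exists>K. \<forall>k\<ge>K. \<forall>l\<ge>K. nrm (ell p) (\<sigma> k - \<sigma> l) < e" if "e > 0" for e
      
    proof -
      obtain K where "\<forall>k l. K \<le> k \<longrightarrow> K \<le> l \<longrightarrow> ?d (\<sigma> k) (\<sigma> l) < e"
        using \<sigma> \<open>e > 0\<close> unfolding M.MCauchy_def by meson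
      then show ?thesis using inX by (auto simp: dist_on_def simp del: ell_sel)
    qed
    have "Cauchy (\<lambda>k. \<sigma> k n)" for n
    proof (rule metric_CauchyI)
      fix e :: real assume "e > 0"
      then obtain K where "\<forall>k\<ge>K. \<forall>l\<ge>K. nrm (ell p) (\<sigma> k - \<sigma> l) < e" using C by blast
      moreover have "dist (\<sigma> k n) (\<sigma> l n) \<le> nrm (ell p) (\<sigma> k - \<sigma> l)" for k l
        using coord[OF closed(4)[OF inX inX], of k l n] by (simp add: dist_norm del: ell_sel)
      ultimately show "\<exists>M. \<forall>m\<ge>M. \<forall>n'\<ge>M. dist (\<sigma> m n) (\<sigma> n' n) < e"
        by (meson le_less_trans)
    qed
    then have "\<forall>n. \<exists>c. (\<lambda>k. \<sigma> k n) \<longlonglongrightarrow> c"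
      by (simp add: Cauchy_convergent_iff convergent_def)
    then obtain x where x: "\<And>n. (\<lambda>k. \<sigma> k n) \<longlonglongrightarrow> x n" by metis
    have lim: "\<exists>K. \<forall>k\<ge>K. \<sigma> k - x \<in> vecs (ell p) \<and> nrm (ell p) (\<sigma> k - x) \<le> e" if e: "e > 0" for e
    proof -
      obtain K where K: "\<And>k l. k \<ge> K \<Longrightarrow> l \<ge> K \<Longrightarrow> nrm (ell p) (\<sigma> k - \<sigma> l) < e"
        using C[OF e] by blast
      have "(\<Sum>n<N. cmod ((\<sigma> k - x) n) powr p) \<le> e powr p" if k: "k \<ge> K" for k N
      proof (rule tendsto_upperbound)
        show "(\<lambda>l. \<Sum>n<N. cmod ((\<sigma> k - \<sigma> l) n) powr p) \<longlonglongrightarrow> (\<Sum>n<N. cmod ((\<sigma> k - x) n) powr p)"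
          using p by (auto intro!: tendsto_intros x)
        show "\<forall>\<^sub>F l in sequentially. (\<Sum>n<N. cmod ((\<sigma> k - \<sigma> l) n) powr p) \<le> e powr p"
          using eventually_ge_at_top[of K]
        proof eventually_elim
          case (elim l)
          then show ?case
            using part[OF closed(4)[OF inX inX]] K[OF k elim] less_imp_le by blast
        qed
      qed simp
      then show ?thesis
        using ell_norm_le[OF p less_imp_le[OF e]] by blast
    qed
    obtain k where "\<sigma> k - x \<in> vecs (ell p)" using lim[of 1] by auto
    then have xX: "x \<in> vecs (ell p)"
      using closed(4)[OF inX[of k]] by (metis diff_diff_eq2 add_diff_cancel_left')
    have "\<exists>K. \<forall>k\<ge>K. \<sigma> k \<in> vecs (ell p) \<and> ?d (\<sigma> k) x < e" if e: "e > 0" for e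
    proof -
      obtain K where "\<And>k. k \<ge> K \<Longrightarrow> nrm (ell p) (\<sigma> k - x) \<le> e / 2"
        using lim[OF half_gt_zero[OF e]] by blast
      then have "nrm (ell p) (\<sigma> k - x) < e" if "k \<ge> K" for k
        using that \<open>e > 0\<close> by (smt (verit) field_sum_of_halves)
      then show ?thesis
        using inX xX by (auto simp: dist_on_def simp del: ell_sel)
    qed
    then have "limitin M.mtopology \<sigma> x sequentially"
      using xX by (simp add: M.limit_metric_sequentially del: ell_sel)
    then show ?thesis by blast
  qed
  then show ?thesis
    using ell_normed[OF p] unfolding complex_banach_space_def M.mcomplete_def by blast
qed

lemma diag_op_bounded:
  assumes p: "1 < p" and "bdd_above (range (\<lambda>n. cmod (lam n)))"
  shows "diag_op lam \<in> bounded_operators (ell p)"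
proof -
  obtain C where C: "\<And>n. cmod (lam n) \<le> C"
    using assms(2) by (auto simp: bdd_above_def)
  have C0: "C \<ge> 0" using C[of 0] norm_ge_zero order_trans by blast
  have b: "diag_op lam x \<in> vecs (ell p)" "nrm (ell p) (diag_op lam x) \<le> C * nrm (ell p) x"
    if x: "x \<in> vecs (ell p)" for x
  proof -
    have "(\<Sum>n<N. cmod (diag_op lam x n) powr p) \<le> (C * nrm (ell p) x) powr p" for N
    proof -
      have "(\<Sum>n<N. cmod (diag_op lam x n) powr p) \<le> (\<Sum>n<N. C powr p * cmod (x n) powr p)"
        using p C C0 by (intro sum_mono)
          (auto simp: diag_op_def norm_mult powr_mult intro!: mult_right_mono powr_mono2)
      also have "\<dots> \<le> C powr p * (\<Sum>n. cmod (x n) powr p)"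
        unfolding sum_distrib_left[symmetric] using x by (intro mult_left_mono sum_le_suminf) auto
      also have "\<dots> = (C * nrm (ell p) x) powr p"
        using ell_norm_powr[OF p x] C0 by (simp add: powr_mult)
      finally show ?thesis .
    qed
    moreover have "C * nrm (ell p) x \<ge> 0" using C0 by simp
    ultimately show "diag_op lam x \<in> vecs (ell p)" "nrm (ell p) (diag_op lam x) \<le> C * nrm (ell p) x"
      using ell_norm_le[OF p] by blast+
  qed
  moreover have "diag_op lam (x + y) = diag_op lam x + diag_op lam y"
    "diag_op lam (scl (ell p) c x) = scl (ell p) c (diag_op lam x)" for x y c
    by (auto simp: diag_op_def fun_eq_iff algebra_simps)
  ultimately show ?thesis
    unfolding bounded_operators_def by blast
qed

end

theory Submission
  imports Defs
begin

text \<open>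
  The norm of \<open>\<ell>\<^sup>p\<close> is differentiable, so each unit vector \<open>x\<close> has exactly one norming functional \<open>f\<close>,
  with coefficients \<open>cnj (sgn (x n)) * \<bar>x n\<bar> powr (p - 1)\<close>. Hence \<open>f (D\<^sup>m x) = (\<Sum>n. a n * lam n ^ m)\<close> with
  \<open>a n = \<bar>x n\<bar> powr p\<close>, and \<open>(x, f) \<mapsto> a\<close> is a continuous surjection from \<open>\<Pi>(\<ell>\<^sup>p)\<close> onto \<open>Delta\<close>, which
  gives (i). For (ii), this map is also open: perturbing \<open>a\<close> while keeping the phases of \<open>x\<close> moves \<open>x\<close>
  and \<open>f\<close> little. So if the generating weights are dense, \<open>D\<close> is transitive; conversely, transitivity
  makes \<open>G_D\<close> an intersection of countably many dense open subsets of the complete space \<open>Delta\<close>,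
  and Baire's theorem applies.
\<close>

section \<open>Norming functionals on the sequence spaces\<close>

declare ell_sel(3) [simp del]

section \<open>Convexity and differentiability of powers of the modulus\<close>

text \<open>Convexity: the graph of \<open>t powr p\<close> lies above its tangent at
  \<open>u\<close>. Young's inequality for \<open>v\<close> and \<open>u powr (p - 1)\<close> yields
  this without differentiating at 0.\<close>

lemma powr_tangent_le:
  fixes u v p :: real
  assumes "1 < p" "0 \<le> u" "0 \<le> v"
  shows "u powr p - v powr p \<le> p * u powr (p - 1) * (u - v)"
proof -
  define q where "q = p / (p - 1)"
  have q: "1 < q" "1 / p + 1 / q = 1" "(p - 1) * q = p"
    using assms by (auto simp: q_def field_simps)
  have "v * u powr (p - 1) \<le> v powr p / p + (u powr (p - 1)) powr q / q"
    using assms q by (intro Youngs_inequality) auto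
  also have "(u powr (p - 1)) powr q = u powr p"
    by (simp add: powr_powr q(3))
  finally have "p * (v * u powr (p - 1)) \<le> p * (v powr p / p + u powr p / q)"
    using assms by (intro mult_left_mono) auto
  also have "\<dots> = v powr p + (p - 1) * u powr p"
    using assms by (simp add: q_def field_simps)
  finally have "p * (v * u powr (p - 1)) \<le> v powr p + (p - 1) * u powr p" .
  moreover have "u * u powr (p - 1) = u powr p"
    using assms by (cases "u = 0") (auto simp: powr_mult_base)
  ultimately show ?thesis
    by (simp add: algebra_simps)
qed

text \<open>After division by \<open>s + t\<close> both ratios lie in [0, 1], where a power with
  exponent at least 1 does not exceed its base; the ratios themselves add up to 1.\<close>

lemma powr_add_le:
  fixes s t p :: real
  assumes "1 \<le> p" "0 \<le> s" "0 \<le> t"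
  shows "s powr p + t powr p \<le> (s + t) powr p"
proof (cases "s + t = 0")
  case False
  then have st: "s + t > 0" using assms by auto
  have *: "r powr p \<le> (s + t) powr p * (r / (s + t))" if "0 \<le> r" "r \<le> s + t" for r
  proof -
    have "r powr p = (s + t) powr p * (r / (s + t)) powr p"
      using st that by (simp flip: powr_mult)
    also have "(r / (s + t)) powr p \<le> r / (s + t)"
      using powr_mono'[of 1 p "r / (s + t)"] st that assms by (cases "r = 0") auto
    finally show ?thesis
      using st by (simp add: mult_left_mono)
  qed
  have "s powr p + t powr p \<le> (s + t) powr p * (s / (s + t)) + (s + t) powr p * (t / (s + t))"
    using assms by (intro add_mono *) auto
  also have "\<dots> = (s + t) powr p"
    using st by (simp flip: distrib_left add_divide_distrib)
  finally show ?thesis .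
qed (use assms in \<open>auto simp: add_nonneg_eq_0_iff\<close>)

text \<open>Superadditivity, with the larger number split into the smaller one and the difference.
  Applied to p-th roots it makes the root map Hoelder continuous in
  \<open>norm_polar_diff_le\<close>.\<close>

lemma abs_diff_powr_le:
  fixes u v p :: real
  assumes "1 \<le> p" "0 \<le> u" "0 \<le> v"
  shows "\<bar>u - v\<bar> powr p \<le> \<bar>u powr p - v powr p\<bar>"
proof (cases "v \<le> u")
  case True
  then show ?thesis using powr_add_le[of p "u - v" v] assms by simp
next
  case False
  then show ?thesis using powr_add_le[of p "v - u" u] assms by simp
qed

text \<open>The squared modulus along the line is a quadratic polynomial in \<open>t\<close> with
  value 1 at 0, so its power \<open>p / 2\<close> can be differentiated there.\<close>

lemma has_derivative_norm_powr_line: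
  "((\<lambda>t. cmod (1 + of_real t * v) powr p) has_real_derivative p * Re v) (at 0)"
proof -
  have eq: "cmod (1 + of_real t * v) powr p = (1 + 2 * t * Re v + t\<^sup>2 * (cmod v)\<^sup>2) powr (p / 2)" for t
  proof -
    have "(cmod (1 + of_real t * v))\<^sup>2 = 1 + 2 * t * Re v + t\<^sup>2 * (cmod v)\<^sup>2"
      unfolding cmod_power2 by (simp add: power2_eq_square algebra_simps)
    moreover have "cmod z powr p = ((cmod z)\<^sup>2) powr (p / 2)" for z
      by (cases "z = 0") (auto simp: powr_powr simp flip: powr_numeral)
    ultimately show ?thesis by simp
  qed
  have "((\<lambda>t. 1 + 2 * t * Re v + t\<^sup>2 * (cmod v)\<^sup>2) has_real_derivative 2 * Re v) (at 0)"
    by (auto intro!: derivative_eq_intros)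
  then have "((\<lambda>t. (1 + 2 * t * Re v + t\<^sup>2 * (cmod v)\<^sup>2) powr (p / 2)) has_real_derivative p * Re v) (at 0)"
    by (rule DERIV_fun_powr[THEN DERIV_cong]) auto
  then show ?thesis
    unfolding eq .
qed

text \<open>At \<open>\<xi> \<noteq> 0\<close> this is the first-order condition at the minimum \<open>s = 0\<close>; at \<open>\<xi> = 0\<close> the right-hand
  side is only \<open>1 + \<bar>s\<bar> powr p\<close>, too small for linear growth in \<open>s\<close>.\<close>

lemma dual_coefficient_unique:
  assumes p: "1 < p"
    and le: "\<And>s. cmod (1 + s * \<phi>) powr p \<le> 1 - cmod \<xi> powr p + cmod (\<xi> + s) powr p"
  shows "\<phi> = cnj (sgn \<xi>) * of_real (cmod \<xi> powr (p - 1))"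
proof (cases "\<xi> = 0")
  case True
  \<comment> \<open>The direction \<open>s = t * cnj \<phi>\<close> makes \<open>s * \<phi>\<close>
    real and nonnegative. Dividing the comparison by \<open>t\<close> leaves the power
    \<open>t powr (p - 1)\<close>, which tends to 0 from the right because
    \<open>p > 1\<close>.\<close>
  have "p * (cmod \<phi>)\<^sup>2 \<le> t powr (p - 1) * cmod \<phi> powr p" if t: "0 < t" for t :: real
  proof -
    have "1 + p * (t * (cmod \<phi>)\<^sup>2) \<le> (1 + t * (cmod \<phi>)\<^sup>2) powr p"
      using powr_tangent_le[OF p, of 1 "1 + t * (cmod \<phi>)\<^sup>2"] t by simp
    also have "1 + t * (cmod \<phi>)\<^sup>2 = cmod (1 + (of_real t * cnj \<phi>) * \<phi>)"
    proof -
      have "1 + (of_real t * cnj \<phi>) * \<phi> = of_real (1 + t * (cmod \<phi>)\<^sup>2)"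
        by (simp add: complex_norm_square[unfolded of_real_power] mult_ac)
      then show ?thesis
        using t by (simp only: norm_of_real) simp
    qed
    also have "\<dots> powr p \<le> 1 + (t * cmod \<phi>) powr p"
      using le[of "of_real t * cnj \<phi>"] t by (simp add: True norm_mult)
    finally have "t * (p * (cmod \<phi>)\<^sup>2) \<le> t powr p * cmod \<phi> powr p"
      by (simp add: powr_mult mult_ac)
    moreover have "t powr p = t * t powr (p - 1)"
      using t by (simp add: powr_mult_base)
    ultimately show ?thesis
      using t by simp
  qed
  moreover have "((\<lambda>t. t powr (p - 1) * cmod \<phi> powr p) \<longlongrightarrow> 0 * cmod \<phi> powr p) (at_right 0)"
    using p by (intro tendsto_mult tendsto_const tendsto_zero_powrI[where b="p-1"])
      (auto simp: eventually_at_right_less intro!: eventually_at_right_less[THEN eventually_mono])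
  ultimately have "p * (cmod \<phi>)\<^sup>2 \<le> 0 * cmod \<phi> powr p"
    by (intro tendsto_lowerbound[where F="at_right 0"])
      (auto intro!: eventually_at_right_less[THEN eventually_mono])
  then have "p * (cmod \<phi>)\<^sup>2 \<le> 0" by simp
  then show ?thesis
    using p True by (simp add: mult_le_0_iff)
next
  case False
  define a where "a = cmod \<xi> powr p"
  \<comment> \<open>Perturbations proportional to \<open>\<xi>\<close> turn
    \<open>cmod (\<xi> + s) powr p\<close> into \<open>a * cmod (1 + t * w) powr p\<close>, so both
    sides are of the form differentiated above. The directions 1 and \<open>\<i>\<close> then
    determine the real and imaginary parts of \<open>\<xi> * \<phi>\<close>.\<close>
  have deriv: "Re (\<xi> * \<phi> * w) = a * Re w" for w
  proof -
    let ?g = "\<lambda>t. 1 - a + a * cmod (1 + of_real t * w) powr p - cmod (1 + of_real t * (\<xi> * \<phi> * w)) powr p"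
    have "(?g has_real_derivative a * (p * Re w) - p * Re (\<xi> * \<phi> * w)) (at 0)"
      by (rule derivative_eq_intros has_derivative_norm_powr_line refl | simp)+
    moreover have "?g 0 \<le> ?g t" for t
    proof -
      have "cmod (\<xi> + of_real t * \<xi> * w) = cmod \<xi> * cmod (1 + of_real t * w)"
        by (simp add: algebra_simps flip: norm_mult)
      then have "cmod (\<xi> + of_real t * \<xi> * w) powr p = a * cmod (1 + of_real t * w) powr p"
        by (simp add: powr_mult a_def)
      then show ?thesis
        using le[of "of_real t * \<xi> * w"] by (simp add: a_def mult_ac)
    qed
    ultimately have "a * (p * Re w) - p * Re (\<xi> * \<phi> * w) = 0"
      by (intro DERIV_local_min[where d=1 and x=0]) auto
    then show ?thesis
      using p by simp
  qed
  have "\<xi> * \<phi> = of_real a"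
    using deriv[of 1] deriv[of \<i>] by (simp add: complex_eq_iff)
  moreover have "\<xi> * (cnj (sgn \<xi>) * of_real (cmod \<xi> powr (p - 1))) = of_real a"
  proof -
    have "\<xi> * cnj (sgn \<xi>) = of_real (cmod \<xi>)"
      using False complex_norm_square[of \<xi>]
      by (simp add: sgn_eq field_simps power2_eq_square)
    moreover have "cmod \<xi> * cmod \<xi> powr (p - 1) = a"
      using False by (simp add: a_def powr_mult_base)
    ultimately show ?thesis
      by (metis mult.assoc of_real_mult)
  qed
  ultimately show ?thesis
    using False by (metis mult_left_cancel)
qed

section \<open>Hoelder duality between conjugate exponents\<close>

lemma ell_norm_nonneg [simp]: "0 \<le> nrm (ell p) x"
  by (simp add: ell_sel(3))

text \<open>The pairing is bilinear; the conjugation sits in \<open>dual_seq\<close>. The value 0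
  off the carrier matches the convention of \<open>dual_space\<close>, so that functionals can be
  compared as functions.\<close>

definition ell_pair :: "real \<Rightarrow> (nat \<Rightarrow> complex) \<Rightarrow> (nat \<Rightarrow> complex) \<Rightarrow> complex" where
  "ell_pair p y z = (if z \<in> vecs (ell p) then \<Sum>n. y n * z n else 0)"

context
  fixes p q :: real
  assumes p: "1 < p" and q: "1 < q" and pq: "1 / p + 1 / q = 1"
begin

lemma conjugate_exponent: "(p - 1) * q = p"
  using p q pq by (auto simp: field_simps)

text \<open>Young's inequality for the coordinates divided by the norms, summed over
  \<open>n\<close>; the two normalised series contribute \<open>1 / p\<close> and
  \<open>1 / q\<close>. If a norm vanishes, so does the sequence.\<close>

lemma ell_Holder:
  assumes y: "y \<in> vecs (ell q)" and z: "z \<in> vecs (ell p)"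
  shows "summable (\<lambda>n. cmod (y n) * cmod (z n))"
    "(\<Sum>n. cmod (y n) * cmod (z n)) \<le> nrm (ell q) y * nrm (ell p) z"
proof -
  define A B where "A = nrm (ell q) y" and "B = nrm (ell p) z"
  have "summable (\<lambda>n. cmod (y n) * cmod (z n)) \<and>
    (\<Sum>n. cmod (y n) * cmod (z n)) \<le> A * B"
  proof (cases "A = 0 \<or> B = 0")
    case True
    then have "y = 0 \<or> z = 0"
      using ell_norm_eq_0[OF q y] ell_norm_eq_0[OF p z] by (auto simp: A_def B_def)
    then show ?thesis by (auto simp: A_def B_def)
  next
    case False
    then have AB: "A > 0" "B > 0"
      by (auto simp: A_def B_def less_le)
    define g where "g n = A * B * (cmod (z n) powr p / B powr p / p + cmod (y n) powr q / A powr q / q)" for n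
    have le: "cmod (y n) * cmod (z n) \<le> g n" for n
    proof -
      have "cmod (z n) / B * (cmod (y n) / A) \<le> (cmod (z n) / B) powr p / p + (cmod (y n) / A) powr q / q"
        using AB p q pq by (intro Youngs_inequality) auto
      then have "A * B * (cmod (z n) / B * (cmod (y n) / A)) \<le>
          A * B * ((cmod (z n) / B) powr p / p + (cmod (y n) / A) powr q / q)"
        using AB by (intro mult_left_mono) auto
      then show ?thesis
        using AB by (simp add: g_def powr_divide mult_ac)
    qed
    have "(\<lambda>n. cmod (z n) powr p) sums B powr p" "(\<lambda>n. cmod (y n) powr q) sums A powr q"
      using y z ell_norm_powr[OF p z] ell_norm_powr[OF q y] by (auto simp: A_def B_def sums_iff)
    then have "g sums (A * B * (B powr p / B powr p / p + A powr q / A powr q / q))"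
      unfolding g_def by (intro sums_mult sums_add sums_divide)
    then have g: "g sums (A * B)"
      using AB pq by simp
    have s: "summable (\<lambda>n. cmod (y n) * cmod (z n))"
      by (rule summable_comparison_test'[OF sums_summable[OF g], of 0]) (use le in auto)
    moreover have "(\<Sum>n. cmod (y n) * cmod (z n)) \<le> A * B"
      using suminf_le[OF le s sums_summable[OF g]] g by (simp add: sums_iff)
    ultimately show ?thesis ..
  qed
  then show "summable (\<lambda>n. cmod (y n) * cmod (z n))"
    "(\<Sum>n. cmod (y n) * cmod (z n)) \<le> nrm (ell q) y * nrm (ell p) z"
    by (simp_all add: A_def B_def)
qed

lemma ell_pair_summable:
  assumes "y \<in> vecs (ell q)" "z \<in> vecs (ell p)"
  shows "summable (\<lambda>n. y n * z n)"
  by (rule summable_norm_cancel) (use ell_Holder(1)[OF assms] in \<open>simp add: norm_mult\<close>)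

lemma ell_pair_le:
  assumes "y \<in> vecs (ell q)" "z \<in> vecs (ell p)"
  shows "cmod (ell_pair p y z) \<le> nrm (ell q) y * nrm (ell p) z"
proof -
  have "cmod (ell_pair p y z) \<le> (\<Sum>n. cmod (y n) * cmod (z n))"
    using summable_norm[of "\<lambda>n. y n * z n"] ell_Holder(1)[OF assms] assms(2)
    by (simp add: ell_pair_def norm_mult)
  then show ?thesis
    using ell_Holder(2)[OF assms] by simp
qed

lemma ell_pair_dual:
  assumes y: "y \<in> vecs (ell q)"
  shows "ell_pair p y \<in> dual_space (ell p)"
proof -
  have "ell_pair p y (x + z) = ell_pair p y x + ell_pair p y z"
    if "x \<in> vecs (ell p)" "z \<in> vecs (ell p)" for x z
    using that ell_norm_add(1)[OF p that] ell_pair_summable[OF y]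
    by (simp add: ell_pair_def distrib_left suminf_add)
  moreover have "ell_pair p y (scl (ell p) c z) = c * ell_pair p y z" if "z \<in> vecs (ell p)" for c z
    using that cns_closed(3)[OF ell_normed[OF p] that, of c] ell_pair_summable[OF y that]
    by (simp add: ell_pair_def mult.left_commute[of _ c] suminf_mult)
  moreover have "\<exists>C. \<forall>z\<in>vecs (ell p). cmod (ell_pair p y z) \<le> C * nrm (ell p) z"
    using ell_pair_le[OF y] by blast
  ultimately show ?thesis
    unfolding dual_space_def by (simp add: ell_pair_def del: ell_sel)
qed

lemma dual_norm_ell_pair_le:
  assumes y: "y \<in> vecs (ell q)"
  shows "dual_norm (ell p) (ell_pair p y) \<le> nrm (ell q) y"
proof (rule dual_norm_least[OF ell_normed[OF p]])
  fix z assume z: "z \<in> vecs (ell p)" "nrm (ell p) z \<le> 1"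
  have "cmod (ell_pair p y z) \<le> nrm (ell q) y * nrm (ell p) z"
    by (rule ell_pair_le[OF y z(1)])
  also have "\<dots> \<le> nrm (ell q) y * 1"
    using z by (intro mult_left_mono) auto
  finally show "cmod (ell_pair p y z) \<le> nrm (ell q) y" by simp
qed

end

section \<open>Coordinates of a bounded functional\<close>

definition unit_seq :: "nat \<Rightarrow> nat \<Rightarrow> complex" where
  "unit_seq n k = of_bool (k = n)"

lemma ell_finite_support:
  assumes "\<And>k. N \<le> k \<Longrightarrow> z k = 0"
  shows "z \<in> vecs (ell p)"
  unfolding ell_sel(1)
proof (rule summable_finite[of "{..<N}"])
  show "cmod (z n) powr p = 0" if "n \<notin> {..<N}" for n
    using that assms by simp
qed simp

lemma ell_unit_seq: "unit_seq n \<in> vecs (ell p)"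
  by (rule ell_finite_support[of "Suc n"]) (auto simp: unit_seq_def)

text \<open>Linearity gives the formula for truncations of \<open>z\<close>. These converge to
  \<open>z\<close> in norm, since the p-th power of the error is a tail of a convergent series, and
  \<open>f\<close> is bounded.\<close>

lemma dual_space_ell_expansion:
  assumes p: "1 < p" and f: "f \<in> dual_space (ell p)" and z: "z \<in> vecs (ell p)"
  shows "(\<lambda>n. f (unit_seq n) * z n) sums f z"
proof -
  define trunc where "trunc N k = (if k < N then z k else 0)" for N k
  have add: "f (x + y) = f x + f y" if "x \<in> vecs (ell p)" "y \<in> vecs (ell p)" for x y
    using f that by (auto simp: dual_space_def simp del: ell_sel)
  have scale: "f (\<lambda>k. c * x k) = c * f x" if "x \<in> vecs (ell p)" for c x
    using f that unfolding dual_space_def by (simp del: ell_sel(1))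
  obtain C where C: "\<And>x. x \<in> vecs (ell p) \<Longrightarrow> cmod (f x) \<le> C * nrm (ell p) x"
    using f unfolding dual_space_def mem_Collect_eq by blast
  have trunc_in: "trunc N \<in> vecs (ell p)" for N
    by (rule ell_finite_support[of N]) (auto simp: trunc_def)
  have f_trunc: "f (trunc N) = (\<Sum>n<N. f (unit_seq n) * z n)" for N
  proof (induction N)
    case 0
    have "trunc 0 = (\<lambda>k. 0 * unit_seq 0 k)" by (auto simp: trunc_def)
    then show ?case using scale[OF ell_unit_seq, of 0 0] by simp
  next
    case (Suc N)
    have "trunc (Suc N) = trunc N + (\<lambda>k. z N * unit_seq N k)"
      by (auto simp: trunc_def unit_seq_def fun_eq_iff less_Suc_eq)
    moreover have "(\<lambda>k. z N * unit_seq N k) \<in> vecs (ell p)"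
      using cns_closed(3)[OF ell_normed[OF p] ell_unit_seq, of "z N" N] by simp
    ultimately have "f (trunc (Suc N)) = f (trunc N) + z N * f (unit_seq N)"
      using add[OF trunc_in] scale[OF ell_unit_seq] by metis
    then show ?case
      using Suc by simp
  qed
  have norm_tail: "nrm (ell p) (z - trunc N) =
      ((\<Sum>n. cmod (z n) powr p) - (\<Sum>n<N. cmod (z n) powr p)) powr (1 / p)" for N
  proof -
    have "(\<Sum>n. cmod ((z - trunc N) n) powr p) = (\<Sum>n. cmod ((z - trunc N) (n + N)) powr p)"
      using cns_closed(4)[OF ell_normed[OF p] z trunc_in]
      by (subst suminf_split_initial_segment[of _ N]) (auto simp: trunc_def)
    also have "\<dots> = (\<Sum>n. cmod (z (n + N)) powr p)"
      by (simp add: trunc_def)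
    also have "\<dots> = (\<Sum>n. cmod (z n) powr p) - (\<Sum>n<N. cmod (z n) powr p)"
      using z by (subst suminf_split_initial_segment[of _ N]) auto
    finally show ?thesis by (simp add: ell_sel(3))
  qed
  have "(\<lambda>N. (\<Sum>n. cmod (z n) powr p) - (\<Sum>n<N. cmod (z n) powr p)) \<longlonglongrightarrow>
      (\<Sum>n. cmod (z n) powr p) - (\<Sum>n. cmod (z n) powr p)"
    using z by (intro tendsto_diff tendsto_const summable_LIMSEQ) auto
  then have "(\<lambda>N. nrm (ell p) (z - trunc N)) \<longlonglongrightarrow> 0"
    unfolding norm_tail using p z
    by (intro tendsto_zero_powrI[where b="1 / p"] tendsto_const) (auto intro!: sum_le_suminf always_eventually)
  then have "(\<lambda>N. C * nrm (ell p) (z - trunc N)) \<longlonglongrightarrow> 0"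
    by (rule tendsto_mult_right_zero)
  moreover have "norm (f (trunc N) - f z) \<le> C * nrm (ell p) (z - trunc N)" for N
  proof -
    have m: "z - trunc N \<in> vecs (ell p)"
      by (rule cns_closed(4)[OF ell_normed[OF p] z trunc_in])
    have "f z = f (trunc N) + f (z - trunc N)"
      using add[OF trunc_in m, of N] by (metis add.commute diff_add_cancel)
    then show ?thesis
      using C[OF m] by simp
  qed
  ultimately have "(\<lambda>N. f (trunc N) - f z) \<longlonglongrightarrow> 0"
    by (rule Lim_null_comparison[OF always_eventually[OF allI], rotated])
  then show ?thesis
    by (simp add: sums_def f_trunc LIM_zero_iff)
qed

section \<open>The duality map on the unit sphere\<close>

definition dual_seq :: "real \<Rightarrow> (nat \<Rightarrow> complex) \<Rightarrow> nat \<Rightarrow> complex" where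
  "dual_seq p x n = cnj (sgn (x n)) * of_real (cmod (x n) powr (p - 1))"

definition weight :: "real \<Rightarrow> (nat \<Rightarrow> complex) \<Rightarrow> nat \<Rightarrow> real" where
  "weight p x = (\<lambda>n. cmod (x n) powr p)"

text \<open>Changing one coordinate changes a single term of the series for the p-th power of the
  norm. This isolates the scalar inequality used in \<open>norming_functional_ell\<close>.\<close>

lemma ell_norm_add_unit_seq:
  fixes s :: complex and n :: nat
  assumes p: "1 < p" and x: "x \<in> vecs (ell p)"
  defines "h \<equiv> x + (\<lambda>k. s * unit_seq n k)"
  shows "h \<in> vecs (ell p)"
    "nrm (ell p) h powr p = nrm (ell p) x powr p - cmod (x n) powr p + cmod (x n + s) powr p"
proof -
  show h: "h \<in> vecs (ell p)"
    using ell_norm_add(1)[OF p x cns_closed(3)[OF ell_normed[OF p] ell_unit_seq, of s n]]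
    by (simp add: h_def)
  let ?r = "\<lambda>k. if k = n then cmod (x n + s) powr p - cmod (x n) powr p else 0"
  have "(\<lambda>k. cmod (x k) powr p) sums (nrm (ell p) x powr p)"
    using x ell_norm_powr[OF p x] by (simp add: sums_iff)
  from sums_add[OF this sums_single[of n "\<lambda>_. cmod (x n + s) powr p - cmod (x n) powr p"]]
  have "(\<lambda>k. cmod (x k) powr p + ?r k) sums
      (nrm (ell p) x powr p + (cmod (x n + s) powr p - cmod (x n) powr p))" .
  moreover have "(\<lambda>k. cmod (x k) powr p + ?r k) = (\<lambda>k. cmod (h k) powr p)"
    by (auto simp: h_def unit_seq_def fun_eq_iff)
  ultimately show "nrm (ell p) h powr p = nrm (ell p) x powr p - cmod (x n) powr p + cmod (x n + s) powr p"
    unfolding ell_norm_powr[OF p h] by (simp add: sums_iff)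
qed

lemma dual_space_bound:
  assumes X: "complex_normed_space X" and f: "f \<in> dual_space X" and x: "x \<in> vecs X"
  shows "cmod (f x) \<le> dual_norm X f * nrm X x"
proof (cases "x = 0")
  case True
  have "f (0 + 0) = f 0 + f 0"
    using f cns_closed(1)[OF X] unfolding dual_space_def by blast
  then show ?thesis
    using True cns_norm(2)[OF X x] by simp
next
  case False
  define r where "r = nrm X x"
  have r: "r > 0" using False cns_norm(1,2)[OF X x] by (simp add: r_def less_le)
  define c where "c = complex_of_real (inverse r)"
  have "nrm X (scl X c x) = 1"
    using r x by (simp add: cns_norm(3)[OF X] c_def norm_inverse flip: r_def)
  then have "cmod (f (scl X c x)) \<le> dual_norm X f"
    using x by (intro dual_norm_upper[OF X f] cns_closed(3)[OF X]) auto
  moreover have "f (scl X c x) = c * f x"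
    using f x by (auto simp: dual_space_def)
  ultimately have "cmod (c * f x) \<le> dual_norm X f" by simp
  then show ?thesis
    using r by (simp add: c_def norm_mult norm_divide divide_simps mult_ac flip: r_def)
qed

text \<open>The bound \<open>\<bar>f h\<bar> \<le> \<parallel>h\<parallel>\<close> is an equality at \<open>h = x\<close>; perturbing only the \<open>n\<close>th coordinate of \<open>x\<close>
  reduces the claim to a scalar first-order condition.\<close>

lemma norming_functional_ell:
  assumes p: "1 < p" and "(x, f) \<in> Pi_set (ell p)"
  shows "f (unit_seq n) = dual_seq p x n"
  unfolding dual_seq_def
proof (rule dual_coefficient_unique[OF p])
  fix s
  have x: "x \<in> vecs (ell p)" "nrm (ell p) x = 1"
    and f: "f \<in> dual_space (ell p)" "dual_norm (ell p) f = 1" "f x = 1"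
    using assms(2) by (auto simp: Pi_set_def simp del: ell_sel)
  let ?h = "x + (\<lambda>k. s * unit_seq n k)"
  note h = ell_norm_add_unit_seq[OF p x(1), of s n]
  have "f ?h = f x + f (scl (ell p) s (unit_seq n))"
    using f(1) x(1) cns_closed(3)[OF ell_normed[OF p] ell_unit_seq, of s n]
    unfolding dual_space_def ell_sel(2) by blast
  also have "f (scl (ell p) s (unit_seq n)) = s * f (unit_seq n)"
    using f(1) ell_unit_seq[of n p] unfolding dual_space_def by (simp del: ell_sel)
  finally have "cmod (1 + s * f (unit_seq n)) = cmod (f ?h)"
    using f(3) by metis
  also have "\<dots> \<le> nrm (ell p) ?h"
    using dual_space_bound[OF ell_normed[OF p] f(1) h(1)] f(2) by simp
  finally have "cmod (1 + s * f (unit_seq n)) powr p \<le> nrm (ell p) ?h powr p"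
    using p by (intro powr_mono2) auto
  then show "cmod (1 + s * f (unit_seq n)) powr p \<le> 1 - cmod (x n) powr p + cmod (x n + s) powr p"
    using h(2) x(2) by simp
qed

lemma dual_seq_mult: "1 < p \<Longrightarrow> dual_seq p x n * x n = of_real (weight p x n)"
proof -
  assume "1 < p"
  have "x n * cnj (sgn (x n)) = of_real (cmod (x n))"
    using complex_norm_square[of "x n"]
    by (cases "x n = 0") (simp_all add: sgn_eq field_simps power2_eq_square)
  moreover have "cmod (x n) * cmod (x n) powr (p - 1) = cmod (x n) powr p"
    by (cases "x n = 0") (simp_all add: powr_mult_base)
  ultimately show ?thesis
    unfolding dual_seq_def weight_def by (metis mult.assoc mult.commute of_real_mult)
qed

lemma cmod_dual_seq: "cmod (dual_seq p x n) = cmod (x n) powr (p - 1)"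
  by (cases "x n = 0") (auto simp: dual_seq_def norm_mult norm_sgn)

lemma weight_in_Delta_iff:
  assumes p: "1 < p"
  shows "weight p x \<in> Delta \<longleftrightarrow> x \<in> vecs (ell p) \<and> nrm (ell p) x = 1"
proof -
  have "nrm (ell p) x = 1 \<longleftrightarrow> (\<Sum>n. cmod (x n) powr p) = 1" if "x \<in> vecs (ell p)"
  proof 
    assume "nrm (ell p) x = 1"
    then show "(\<Sum>n. cmod (x n) powr p) = 1"
      using ell_norm_powr[OF p that] by simp
  qed (simp add: ell_sel(3))
  then show ?thesis
    by (auto simp: Delta_def weight_def sums_iff)
qed

text \<open>Since \<open>(p - 1) * q = p\<close>, the dual sequence has for exponent
  \<open>q\<close> the same weights as \<open>x\<close> has for \<open>p\<close>, so the criterion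
  for unit vectors carries over.\<close>

lemma dual_seq_in_ell:
  assumes p: "1 < p" and q: "1 < q" "1 / p + 1 / q = 1" and w: "weight p x \<in> Delta"
  shows "dual_seq p x \<in> vecs (ell q)" "nrm (ell q) (dual_seq p x) = 1"
proof -
  have "weight q (dual_seq p x) = weight p x"
    using conjugate_exponent[OF p q] by (auto simp: weight_def cmod_dual_seq powr_powr)
  then show "dual_seq p x \<in> vecs (ell q)" "nrm (ell q) (dual_seq p x) = 1"
    using w weight_in_Delta_iff[OF q(1), of "dual_seq p x"] by auto
qed

text \<open>Forwards, a functional is determined by its coordinates, and norming \<open>x\<close>
  fixes each of them. Backwards, Hoelder's inequality bounds the dual norm by 1, and the value 1 at
  \<open>x\<close> shows that the bound is attained.\<close>

lemma Pi_set_ell: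
  assumes p: "1 < p"
  shows "(x, f) \<in> Pi_set (ell p) \<longleftrightarrow> weight p x \<in> Delta \<and> f = ell_pair p (dual_seq p x)"
proof
  assume Pi: "(x, f) \<in> Pi_set (ell p)"
  then have f: "f \<in> dual_space (ell p)"
    by (simp add: Pi_set_def)
  have "f z = ell_pair p (dual_seq p x) z" for z
  proof (cases "z \<in> vecs (ell p)")
    case True
    then show ?thesis
      using dual_space_ell_expansion[OF p f True] norming_functional_ell[OF p Pi]
      by (simp add: ell_pair_def sums_iff del: ell_sel)
  next
    case False
    then show ?thesis using f by (simp add: dual_space_def ell_pair_def del: ell_sel)
  qed
  then show "weight p x \<in> Delta \<and> f = ell_pair p (dual_seq p x)"
    using Pi weight_in_Delta_iff[OF p, of x] by (auto simp: Pi_set_def simp del: ell_sel)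
next
  assume *: "weight p x \<in> Delta \<and> f = ell_pair p (dual_seq p x)"
  define q where "q = p / (p - 1)"
  have q: "1 < q" "1 / p + 1 / q = 1"
    using p by (auto simp: q_def field_simps)
  have x: "x \<in> vecs (ell p)" "nrm (ell p) x = 1"
    using * weight_in_Delta_iff[OF p] by auto
  note d = dual_seq_in_ell[OF p q conjunct1[OF *]]
  have f: "f \<in> dual_space (ell p)"
    using * ell_pair_dual[OF p q d(1)] by simp
  have "f x = (\<Sum>n. of_real (weight p x n))"
    using * x by (simp add: ell_pair_def dual_seq_mult[OF p])
  also have "\<dots> = 1"
    using * by (simp add: Delta_def sums_iff suminf_of_real[symmetric])
  finally have fx: "f x = 1" .
  have "dual_norm (ell p) f \<le> 1"
    using dual_norm_ell_pair_le[OF p q d(1)] d(2) * by simp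
  moreover have "1 \<le> dual_norm (ell p) f"
    using dual_norm_upper[OF ell_normed[OF p] f x(1)] x(2) fx by simp
  ultimately show "(x, f) \<in> Pi_set (ell p)"
    using x f fx by (simp add: Pi_set_def del: ell_sel)
qed

section \<open>Numerical orbits as moment sequences\<close>

definition moment :: "(nat \<Rightarrow> complex) \<Rightarrow> (nat \<Rightarrow> real) \<Rightarrow> nat \<Rightarrow> complex" where
  "moment lam a m = (\<Sum>n. of_real (a n) * lam n ^ m)"

lemma moment_0: "a \<in> Delta \<Longrightarrow> moment lam a 0 = 1"
  by (simp add: moment_def Delta_def sums_iff suminf_of_real[symmetric])

text \<open>The separately adjoined point 1 is the moment of order 0: \<open>lam n ^ 0 = 1\<close>
  even when \<open>lam n = 0\<close>, and the weights add up to 1.\<close>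

lemma orbit_D_eq:
  assumes "a \<in> Delta"
  shows "orbit_D lam a = range (moment lam a)"
proof -
  have "orbit_D lam a = insert (moment lam a 0) (moment lam a ` {1..})"
    unfolding moment_0[OF assms] by (auto simp: orbit_D_def moment_def)
  also have "\<dots> = moment lam a ` insert 0 {1..}" by simp
  also have "insert 0 {1..} = (UNIV :: nat set)" by auto
  finally show ?thesis .
qed

lemma diag_op_power: "(diag_op lam ^^ m) x = (\<lambda>n. lam n ^ m * x n)"
  by (induction m) (auto simp: diag_op_def)

lemma numerical_orbit_diag_op:
  assumes p: "1 < p" and lam: "bdd_above (range (\<lambda>n. cmod (lam n)))"
    and Pi: "(x, f) \<in> Pi_set (ell p)"
  shows "f ((diag_op lam ^^ m) x) = moment lam (weight p x) m"
proof -
  have x: "x \<in> vecs (ell p)"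
    using Pi by (simp add: Pi_set_def)
  \<comment> \<open>Off the carrier \<open>ell_pair\<close> is 0, so the series formula requires
    this membership.\<close>
  have "(diag_op lam ^^ m) x \<in> vecs (ell p)"
    by (induction m) (use x diag_op_bounded[OF p lam] in \<open>auto simp: bounded_operators_def simp del: ell_sel\<close>)
  moreover have "f = ell_pair p (dual_seq p x)"
    using Pi Pi_set_ell[OF p] by simp
  ultimately have "f ((diag_op lam ^^ m) x) = (\<Sum>n. dual_seq p x n * (lam n ^ m * x n))"
    by (simp add: ell_pair_def diag_op_power del: ell_sel)
  also have "\<dots> = (\<Sum>n. (dual_seq p x n * x n) * lam n ^ m)"
    by (simp add: mult_ac)
  finally show ?thesis
    by (simp add: dual_seq_mult[OF p] moment_def)
qed

section \<open>The weight map onto the simplex\<close>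

definition l1_dist :: "(nat \<Rightarrow> real) \<Rightarrow> (nat \<Rightarrow> real) \<Rightarrow> real" where
  "l1_dist a b = (\<Sum>n. \<bar>a n - b n\<bar>)"

interpretation Delta: Metric_space Delta "dist_on Delta l1_dist"
  using Metric_space_Delta by (simp add: l1_dist_def[abs_def])

lemma Delta_topology_eq: "Delta_topology = Delta.mtopology"
  by (simp add: Delta_topology_def l1_dist_def[abs_def])

lemma Delta_summable: "a \<in> Delta \<Longrightarrow> summable a"
  by (simp add: Delta_def sums_iff)

lemma Delta_summable_diff:
  assumes "a \<in> Delta" "b \<in> Delta"
  shows "summable (\<lambda>n. \<bar>a n - b n\<bar>)"
proof (rule summable_comparison_test'[OF summable_add[of a b], of 0])
  show "norm \<bar>a n - b n\<bar> \<le> a n + b n" for n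
    using assms by (auto simp: Delta_def abs_le_iff add_increasing add_increasing2 diff_le_eq)
qed (use assms Delta_summable in auto)

text \<open>The limit is taken coordinatewise. The Cauchy condition in the l1 distance prevents mass
  from escaping to infinity, so the limit again has total mass 1.\<close>

lemma Delta_mcomplete: "Delta.mcomplete"
  unfolding Delta.mcomplete_def
proof (intro allI impI)
  fix \<sigma> assume \<sigma>: "Delta.MCauchy \<sigma>"
  have mem: "\<sigma> k \<in> Delta" for k
    using \<sigma> by (auto simp: Delta.MCauchy_def)
  have C: "\<exists>K. \<forall>k\<ge>K. \<forall>l\<ge>K. l1_dist (\<sigma> k) (\<sigma> l) < e" if "e > 0" for e
  proof -
    obtain K where "\<forall>k l. K \<le> k \<longrightarrow> K \<le> l \<longrightarrow> dist_on Delta l1_dist (\<sigma> k) (\<sigma> l) < e"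
      using \<sigma> \<open>e > 0\<close> unfolding Delta.MCauchy_def by meson
    then show ?thesis using mem by (auto simp: dist_on_def)
  qed
  have partial: "(\<Sum>n<N. \<bar>\<sigma> k n - \<sigma> l n\<bar>) \<le> l1_dist (\<sigma> k) (\<sigma> l)" for k l N
    unfolding l1_dist_def by (intro sum_le_suminf Delta_summable_diff mem) auto
  have "Cauchy (\<lambda>k. \<sigma> k n)" for n
  proof (rule metric_CauchyI)
    fix e :: real assume "e > 0"
    then obtain K where "\<forall>k\<ge>K. \<forall>l\<ge>K. l1_dist (\<sigma> k) (\<sigma> l) < e" using C by blast
    moreover have "dist (\<sigma> k n) (\<sigma> l n) \<le> l1_dist (\<sigma> k) (\<sigma> l)" for k l
    proof -
      have "dist (\<sigma> k n) (\<sigma> l n) \<le> (\<Sum>i<Suc n. \<bar>\<sigma> k i - \<sigma> l i\<bar>)"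
        by (simp add: dist_real_def sum_nonneg)
      then show ?thesis using partial[of k l "Suc n"] by simp
    qed
    ultimately show "\<exists>M. \<forall>k\<ge>M. \<forall>l\<ge>M. dist (\<sigma> k n) (\<sigma> l n) < e"
      by (meson le_less_trans)
  qed
  then have "\<forall>n. \<exists>c. (\<lambda>k. \<sigma> k n) \<longlonglongrightarrow> c"
    by (simp add: Cauchy_convergent_iff convergent_def)
  then obtain a where a: "\<And>n. (\<lambda>k. \<sigma> k n) \<longlonglongrightarrow> a n" by metis
  have lim: "\<exists>K. \<forall>k\<ge>K. summable (\<lambda>n. \<bar>\<sigma> k n - a n\<bar>) \<and> l1_dist (\<sigma> k) a \<le> e" if e: "e > 0" for e
  proof -
    obtain K where K: "\<And>k l. k \<ge> K \<Longrightarrow> l \<ge> K \<Longrightarrow> l1_dist (\<sigma> k) (\<sigma> l) < e"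
      using C[OF e] by blast
    \<comment> \<open>A Fatou argument: the bound on finite partial sums is uniform in
      \<open>l\<close> and in \<open>N\<close>, so \<open>l\<close> may tend to infinity
      first.\<close>
    have le: "(\<Sum>n<N. \<bar>\<sigma> k n - a n\<bar>) \<le> e" if k: "k \<ge> K" for k N
    proof (rule tendsto_upperbound)
      show "(\<lambda>l. \<Sum>n<N. \<bar>\<sigma> k n - \<sigma> l n\<bar>) \<longlonglongrightarrow> (\<Sum>n<N. \<bar>\<sigma> k n - a n\<bar>)"
        by (intro tendsto_intros a)
      show "\<forall>\<^sub>F l in sequentially. (\<Sum>n<N. \<bar>\<sigma> k n - \<sigma> l n\<bar>) \<le> e"
        using eventually_ge_at_top[of K]
        by eventually_elim (use partial K[OF k] in \<open>meson less_imp_le order_trans\<close>)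
    qed simp
    have "summable (\<lambda>n. \<bar>\<sigma> k n - a n\<bar>)" if "k \<ge> K" for k
      by (rule summableI_nonneg_bounded[OF _ le[OF that]]) simp
    then show ?thesis
      unfolding l1_dist_def using le by (blast intro: suminf_le_const)
  qed
  have "a \<in> Delta"
  proof -
    have nonneg: "0 \<le> a n" for n
      by (rule tendsto_lowerbound[OF a]) (use mem in \<open>auto simp: Delta_def\<close>)
    have sum: "summable a \<and> \<bar>1 - suminf a\<bar> \<le> e" if e: "e > 0" for e
    proof -
      obtain k where k: "summable (\<lambda>n. \<bar>\<sigma> k n - a n\<bar>)" "l1_dist (\<sigma> k) a \<le> e"
        using lim[OF e] by blast
      have s: "summable (\<lambda>n. \<sigma> k n - a n)"
        using k(1) by (rule summable_rabs_cancel)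
      have "summable a"
        using summable_diff[OF Delta_summable[OF mem[of k]] s] by simp
      moreover have "1 - suminf a = (\<Sum>n. \<sigma> k n - a n)"
        using mem[of k] \<open>summable a\<close> by (simp add: Delta_def sums_iff flip: suminf_diff)
      moreover have "\<bar>\<Sum>n. \<sigma> k n - a n\<bar> \<le> l1_dist (\<sigma> k) a"
        unfolding l1_dist_def by (rule summable_rabs[OF k(1)])
      ultimately show ?thesis using k(2) by simp
    qed
    have "\<bar>1 - suminf a\<bar> \<le> 0"
      by (rule field_le_epsilon) (use sum in auto)
    then show ?thesis
      using nonneg sum[of 1] by (simp add: Delta_def sums_iff)
  qed
  moreover have "\<exists>K. \<forall>k\<ge>K. \<sigma> k \<in> Delta \<and> dist_on Delta l1_dist (\<sigma> k) a < e" if e: "e > 0" for e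
  proof -
    obtain K where "\<And>k. k \<ge> K \<Longrightarrow> l1_dist (\<sigma> k) a \<le> e / 2"
      using lim[OF half_gt_zero[OF e]] by blast
    then have "l1_dist (\<sigma> k) a < e" if "k \<ge> K" for k
      using that e by (smt (verit) field_sum_of_halves)
    then show ?thesis
      using mem \<open>a \<in> Delta\<close> by (auto simp: dist_on_def)
  qed
  ultimately show "\<exists>a. limitin Delta.mtopology \<sigma> a sequentially"
    by (auto simp: Delta.limit_metric_sequentially)
qed

section \<open>Continuity of the weight map\<close>

text \<open>The tangent inequality in both orders bounds each difference of weights by
  \<open>p * cmod (x n - y n)\<close> times the sum of the moduli of the two dual coefficients. Both
  dual sequences have norm 1, so Hoelder's inequality gives \<open>p\<close> twice.\<close>

lemma weight_Lipschitz:
  assumes p: "1 < p" and x: "weight p x \<in> Delta" and y: "weight p y \<in> Delta"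
  shows "l1_dist (weight p x) (weight p y) \<le> 2 * p * nrm (ell p) (x - y)"
proof -
  define q where "q = p / (p - 1)"
  have q: "1 < q" "1 / p + 1 / q = 1"
    using p by (auto simp: q_def field_simps)
  define z where "z = x - y"
  have z: "z \<in> vecs (ell p)"
    unfolding z_def using x y weight_in_Delta_iff[OF p] by (intro cns_closed[OF ell_normed[OF p]]) auto
  have H: "summable (\<lambda>n. cmod (dual_seq p w n) * cmod (z n))"
    "(\<Sum>n. cmod (dual_seq p w n) * cmod (z n)) \<le> nrm (ell p) z" if "weight p w \<in> Delta" for w
    using ell_Holder[OF p q dual_seq_in_ell(1)[OF p q that] z] dual_seq_in_ell(2)[OF p q that] by auto
  have le: "\<bar>weight p x n - weight p y n\<bar> \<le>
      p * (cmod (dual_seq p x n) * cmod (z n)) + p * (cmod (dual_seq p y n) * cmod (z n))" for n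
  proof -
    have "cmod u powr p - cmod v powr p \<le> p * (cmod u powr (p - 1) * cmod (u - v))" for u v
    proof -
      have "cmod u powr p - cmod v powr p \<le> p * cmod u powr (p - 1) * (cmod u - cmod v)"
        using p by (intro powr_tangent_le) auto
      also have "\<dots> \<le> p * cmod u powr (p - 1) * cmod (u - v)"
        using p norm_triangle_ineq2[of u v] by (intro mult_left_mono) auto
      finally show ?thesis by (simp add: mult_ac)
    qed
    from this[of "x n" "y n"] this[of "y n" "x n"]
    have "weight p x n - weight p y n \<le> p * (cmod (dual_seq p x n) * cmod (z n))"
      "weight p y n - weight p x n \<le> p * (cmod (dual_seq p y n) * cmod (z n))"
      by (simp_all add: weight_def cmod_dual_seq z_def norm_minus_commute)
    moreover have "0 \<le> p * (cmod (dual_seq p w n) * cmod (z n))" for w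
      using p by simp
    ultimately show ?thesis
      by (smt (verit))
  qed
  have "l1_dist (weight p x) (weight p y) \<le>
      (\<Sum>n. p * (cmod (dual_seq p x n) * cmod (z n)) + p * (cmod (dual_seq p y n) * cmod (z n)))"
    unfolding l1_dist_def
    by (intro suminf_le le Delta_summable_diff x y summable_add summable_mult H(1))
  also have "\<dots> = p * (\<Sum>n. cmod (dual_seq p x n) * cmod (z n)) + p * (\<Sum>n. cmod (dual_seq p y n) * cmod (z n))"
    using H(1)[OF x] H(1)[OF y]
    by (simp add: suminf_add[symmetric] suminf_mult summable_mult)
  also have "\<dots> \<le> p * nrm (ell p) z + p * nrm (ell p) z"
    using p H(2)[OF x] H(2)[OF y] by (intro add_mono mult_left_mono) auto
  finally show ?thesis by (simp add: z_def)
qed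

section \<open>Lifting weights with prescribed phases\<close>

text \<open>For unimodular \<open>u\<close> this is a right inverse of \<open>weight p\<close> on
  \<open>Delta\<close>. Fixing \<open>u\<close> while \<open>a\<close> varies moves a point of the
  sphere along with its weights, which is how openness of the weight map is obtained.\<close>

definition polar :: "real \<Rightarrow> (nat \<Rightarrow> complex) \<Rightarrow> (nat \<Rightarrow> real) \<Rightarrow> nat \<Rightarrow> complex" where
  "polar p u a n = u n * of_real (a n powr (1 / p))"

lemma weight_polar:
  assumes "1 < p" "\<forall>n. cmod (u n) = 1" "a \<in> Delta"
  shows "weight p (polar p u a) = a"
  using assms by (auto simp: weight_def polar_def norm_mult powr_powr Delta_def fun_eq_iff)

text \<open>Vanishing coordinates get the phase 1 instead of \<open>sgn 0 = 0\<close>: the phases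
  must be unimodular, because such a coordinate may become nonzero once the weights are
  perturbed.\<close>

lemma polar_weight:
  assumes "1 < p"
  shows "polar p (\<lambda>n. if x n = 0 then 1 else sgn (x n)) (weight p x) = x"
proof
  fix n
  show "polar p (\<lambda>n. if x n = 0 then 1 else sgn (x n)) (weight p x) n = x n"
    using assms by (auto simp: weight_def polar_def powr_powr sgn_eq)
qed

text \<open>In polar form the duality map conjugates the phases and replaces \<open>p\<close> by
  \<open>q\<close>, so estimates for vectors also serve for their norming functionals.\<close>

lemma dual_seq_polar:
  assumes "1 < p" "1 < q" "1 / p + 1 / q = 1" "\<forall>n. cmod (u n) = 1" "a \<in> Delta"
  shows "dual_seq p (polar p u a) = polar q (\<lambda>n. cnj (u n)) a"
proof
  fix n
  have "(a n powr (1 / p)) powr (p - 1) = a n powr (1 / q)"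
  proof -
    have "(1 / p) * (p - 1) = 1 / q"
      using assms by (simp add: field_simps)
    then show ?thesis by (simp add: powr_powr)
  qed
  moreover have "sgn (u n) = u n"
    using spec[OF assms(4), of n] by (simp add: sgn_eq)
  ultimately show "dual_seq p (polar p u a) n = polar q (\<lambda>n. cnj (u n)) a n"
    using spec[OF assms(4), of n] by (cases "a n = 0") (auto simp: dual_seq_def polar_def norm_mult sgn_mult sgn_of_real)
qed

lemma polar_in_ell:
  assumes "1 < p" "\<forall>n. cmod (u n) = 1" "a \<in> Delta"
  shows "polar p u a \<in> vecs (ell p)"
  using weight_in_Delta_iff[OF assms(1), of "polar p u a"] weight_polar[OF assms] assms(3) by simp

lemma norm_polar_diff_le:
  assumes p: "1 < p" and u: "\<forall>n. cmod (u n) = 1" and a: "a \<in> Delta" and b: "b \<in> Delta"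
  shows "nrm (ell p) (polar p u a - polar p u b) \<le> l1_dist a b powr (1 / p)"
proof -
  have "cmod ((polar p u a - polar p u b) n) powr p \<le> \<bar>a n - b n\<bar>" for n
  proof -
    have "(polar p u a - polar p u b) n = u n * of_real (a n powr (1 / p) - b n powr (1 / p))"
      by (simp add: polar_def algebra_simps)
    then have "cmod ((polar p u a - polar p u b) n) = \<bar>a n powr (1 / p) - b n powr (1 / p)\<bar>"
      using u by (simp only: norm_mult norm_of_real) simp
    moreover have "0 \<le> a n" "0 \<le> b n" using a b by (auto simp: Delta_def)
    ultimately show ?thesis
      using abs_diff_powr_le[of p "a n powr (1 / p)" "b n powr (1 / p)"] p by (simp add: powr_powr)
  qed
  moreover have d: "polar p u a - polar p u b \<in> vecs (ell p)"
    by (intro cns_closed[OF ell_normed[OF p]] polar_in_ell p u a b)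
  ultimately have "(\<Sum>n. cmod ((polar p u a - polar p u b) n) powr p) \<le> l1_dist a b"
    unfolding l1_dist_def using Delta_summable_diff[OF a b] by (intro suminf_le) auto
  then show ?thesis
    unfolding ell_sel(3) using p d[unfolded ell_sel(1)] by (intro powr_mono2 suminf_nonneg) auto
qed

lemma ell_pair_diff:
  assumes p: "1 < p" and q: "1 < q" "1 / p + 1 / q = 1"
    and y: "y \<in> vecs (ell q)" and y': "y' \<in> vecs (ell q)"
  shows "ell_pair p y z - ell_pair p y' z = ell_pair p (y - y') z"
  using ell_pair_summable[OF p q y] ell_pair_summable[OF p q y']
  by (auto simp: ell_pair_def left_diff_distrib suminf_diff)

text \<open>The vector part is estimated with exponent \<open>p\<close>, the functional part by the
  same lemma with \<open>q\<close> and conjugated phases; hence the maximum of two powers.\<close>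

lemma Pi_dist_polar_le:
  assumes p: "1 < p" and q: "1 < q" "1 / p + 1 / q = 1" and u: "\<forall>n. cmod (u n) = 1"
    and a: "a \<in> Delta" and b: "b \<in> Delta"
  defines "P c \<equiv> (polar p u c, ell_pair p (dual_seq p (polar p u c)))"
  shows "Pi_dist (ell p) (P a) (P b) \<le> max (l1_dist a b powr (1 / p)) (l1_dist a b powr (1 / q))"
proof -
  let ?v = "\<lambda>n. cnj (u n)"
  have v: "\<forall>n. cmod (?v n) = 1" using u by simp
  have in_ell: "polar q ?v a \<in> vecs (ell q)" "polar q ?v b \<in> vecs (ell q)"
    by (intro polar_in_ell q(1) v a b)+
  have "dual_norm (ell p) (ell_pair p (polar q ?v a - polar q ?v b)) \<le> l1_dist a b powr (1 / q)"
    using dual_norm_ell_pair_le[OF p q cns_closed(4)[OF ell_normed[OF q(1)] in_ell]]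
      norm_polar_diff_le[of q ?v a b, OF q(1) v a b] by (rule order_trans)
  moreover have "ell_pair p (polar q ?v a - polar q ?v b) =
      (\<lambda>z. ell_pair p (dual_seq p (polar p u a)) z - ell_pair p (dual_seq p (polar p u b)) z)"
    using ell_pair_diff[OF p q in_ell] dual_seq_polar[OF p q u a] dual_seq_polar[OF p q u b] by auto
  ultimately show ?thesis
    using norm_polar_diff_le[OF p u a b] unfolding Pi_dist_def P_def by auto
qed

section \<open>Continuity of the moments\<close>

lemma moment_diff_le:
  assumes C: "\<forall>n. cmod (lam n) \<le> C" and a: "a \<in> Delta" and b: "b \<in> Delta"
  shows "cmod (moment lam a m - moment lam b m) \<le> C ^ m * l1_dist a b"
proof -
  have pow: "cmod (lam n ^ m) \<le> C ^ m" for n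
    unfolding norm_power using C by (intro power_mono) auto
  have s: "summable (\<lambda>n. of_real (c n) * lam n ^ m)" if "c \<in> Delta" for c
  proof (rule summable_comparison_test'[OF summable_mult[OF Delta_summable[OF that], of "C ^ m"], of 0])
    show "norm (of_real (c n) * lam n ^ m) \<le> C ^ m * c n" for n
      using that mult_right_mono[OF pow[of n], of "c n"] by (simp add: Delta_def norm_mult mult_ac)
  qed
  have "moment lam a m - moment lam b m = (\<Sum>n. of_real (a n - b n) * lam n ^ m)"
    unfolding moment_def using suminf_diff[OF s[OF a] s[OF b]] by (simp add: left_diff_distrib)
  also have "cmod \<dots> \<le> (\<Sum>n. C ^ m * \<bar>a n - b n\<bar>)"
  proof (rule norm_suminf_le)
    show "cmod (of_real (a n - b n) * lam n ^ m) \<le> C ^ m * \<bar>a n - b n\<bar>" for n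
      using mult_right_mono[OF pow[of n], of "\<bar>a n - b n\<bar>"] by (simp add: norm_mult mult_ac del: of_real_diff)
  qed (intro summable_mult Delta_summable_diff a b)
  also have "\<dots> = C ^ m * l1_dist a b"
    unfolding l1_dist_def using Delta_summable_diff[OF a b] by (rule suminf_mult)
  finally show ?thesis .
qed

text \<open>Each single moment is Lipschitz in the weights. The constant \<open>C ^ m\<close> may
  grow with \<open>m\<close>, but the radius is chosen after \<open>m\<close> is fixed.\<close>

lemma openin_moment:
  assumes lam: "bdd_above (range (\<lambda>n. cmod (lam n)))" and V: "open V"
  shows "openin Delta.mtopology {a \<in> Delta. \<exists>m. moment lam a m \<in> V}"
  unfolding Delta.openin_mtopology
proof safe
  fix a m assume a: "a \<in> Delta" and m: "moment lam a m \<in> V"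
  obtain C' where C': "\<And>n. cmod (lam n) \<le> C'"
    using lam by (auto simp: bdd_above_def)
  \<comment> \<open>The maximum with 1 keeps \<open>C ^ m\<close> positive even if all
    \<open>lam n\<close> are 0.\<close>
  define C where "C = max C' 1"
  have C: "\<forall>n. cmod (lam n) \<le> C" using C' by (simp add: C_def le_max_iff_disj)
  have Cm: "C ^ m > 0" by (simp add: C_def)
  obtain e where e: "e > 0" "\<And>z. dist z (moment lam a m) < e \<Longrightarrow> z \<in> V"
    using V m unfolding open_dist by blast
  show "\<exists>r>0. Delta.mball a r \<subseteq> {a \<in> Delta. \<exists>m. moment lam a m \<in> V}"
  proof (intro exI[of _ "e / C ^ m"] conjI subsetI)
    fix b assume "b \<in> Delta.mball a (e / C ^ m)"
    then have b: "b \<in> Delta" and "l1_dist a b < e / C ^ m"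
      unfolding Delta.in_mball by (auto simp: dist_on_def)
    then have "C ^ m * l1_dist a b < e"
      using Cm by (simp add: pos_less_divide_eq mult.commute)
    then have "dist (moment lam b m) (moment lam a m) < e"
      using moment_diff_le[OF C a b, of m] by (simp add: dist_norm norm_minus_commute)
    then show "b \<in> {a \<in> Delta. \<exists>m. moment lam a m \<in> V}"
      using b e by blast
  qed (use e Cm in simp)
qed

lemma G_D_iff: "a \<in> G_D lam \<longleftrightarrow> a \<in> Delta \<and> closure (range (moment lam a)) = UNIV"
  by (auto simp: G_D_def orbit_D_eq)

lemma Pi_set_polar:
  assumes "1 < p" "\<forall>n. cmod (u n) = 1" "a \<in> Delta"
  shows "(polar p u a, ell_pair p (dual_seq p (polar p u a))) \<in> Pi_set (ell p)"
  using assms by (simp add: Pi_set_ell weight_polar)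

section \<open>The two equivalences\<close>

lemma numerically_hypercyclic_diag_op_iff:
  assumes p: "1 < p" and lam: "bdd_above (range (\<lambda>n. cmod (lam n)))"
  shows "numerically_hypercyclic (ell p) (diag_op lam) \<longleftrightarrow> G_D lam \<noteq> {}"
proof -
  have orbit: "{f ((diag_op lam ^^ n) x) |n. True} = range (moment lam (weight p x))"
    if "(x, f) \<in> Pi_set (ell p)" for x f
    using numerical_orbit_diag_op[OF p lam that] by auto
  show ?thesis
  proof
    assume "numerically_hypercyclic (ell p) (diag_op lam)"
    then obtain x f where xf: "(x, f) \<in> Pi_set (ell p)" "closure {f ((diag_op lam ^^ n) x) |n. True} = UNIV"
      unfolding numerically_hypercyclic_def by blast
    then have "weight p x \<in> G_D lam"
      using Pi_set_ell[OF p, of x f] orbit[OF xf(1)] by (simp add: G_D_iff)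
    then show "G_D lam \<noteq> {}" by blast
  next
    assume "G_D lam \<noteq> {}"
    then obtain a where a: "a \<in> G_D lam" by blast
    then have aD: "a \<in> Delta" by (simp add: G_D_iff)
    \<comment> \<open>The orbit depends on the weights alone, so the phases can be chosen
      freely.\<close>
    let ?x = "polar p (\<lambda>_. 1) a"
    have Pi: "(?x, ell_pair p (dual_seq p ?x)) \<in> Pi_set (ell p)"
      by (rule Pi_set_polar[OF p _ aD]) simp
    have "weight p ?x = a"
      by (rule weight_polar[OF p _ aD]) simp
    then have "closure {ell_pair p (dual_seq p ?x) ((diag_op lam ^^ n) ?x) |n. True} = UNIV"
      using a orbit[OF Pi] by (simp add: G_D_iff)
    then show "numerically_hypercyclic (ell p) (diag_op lam)"
      unfolding numerically_hypercyclic_def using Pi diag_op_bounded[OF p lam] by blast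
  qed
qed

lemma G_D_dense_imp_transitive:
  assumes p: "1 < p" and lam: "bdd_above (range (\<lambda>n. cmod (lam n)))"
    and dense: "Delta.mtopology closure_of G_D lam = Delta"
  shows "topologically_numerically_transitive (ell p) (diag_op lam)"
  unfolding topologically_numerically_transitive_def
proof (intro conjI allI impI)
  interpret Pi: Metric_space "Pi_set (ell p)" "dist_on (Pi_set (ell p)) (Pi_dist (ell p))"
    by (rule Metric_space_Pi[OF ell_normed[OF p]])
  define q where "q = p / (p - 1)"
  have q: "1 < q" "1 / p + 1 / q = 1"
    using p by (auto simp: q_def field_simps)
  show "diag_op lam \<in> bounded_operators (ell p)"
    by (rule diag_op_bounded[OF p lam])
  fix U and V :: "complex set"
  assume "openin (Pi_topology (ell p)) U \<and> U \<noteq> {} \<and> open V \<and> V \<noteq> {}"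
  then have U: "openin Pi.mtopology U" "U \<noteq> {}" and V: "open V" "V \<noteq> {}"
    by (auto simp: Pi_topology_def)
  obtain x f where xf: "(x, f) \<in> U" using U(2) by auto
  obtain r where r: "r > 0" "Pi.mball (x, f) r \<subseteq> U" "(x, f) \<in> Pi_set (ell p)"
    using U(1) xf unfolding Pi.openin_mtopology by blast
  define u where "u n = (if x n = 0 then 1 else sgn (x n))" for n
  have u: "\<forall>n. cmod (u n) = 1" by (simp add: u_def norm_sgn)
  define a where "a = weight p x"
  have a: "a \<in> Delta" and x: "x = polar p u a" and f: "f = ell_pair p (dual_seq p x)"
    using r(3) Pi_set_ell[OF p] polar_weight[OF p, of x] by (auto simp: a_def u_def[abs_def])
  \<comment> \<open>With this radius both powers in \<open>Pi_dist_polar_le\<close> fall below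
    \<open>r\<close>.\<close>
  define s where "s = min (r powr p) (r powr q)"
  have "s > 0" using r by (simp add: s_def)
  then obtain b where b: "b \<in> G_D lam" "b \<in> Delta.mball a s"
    using dense a unfolding Delta.metric_closure_of by blast
  then have bD: "b \<in> Delta" and ab: "l1_dist a b < s"
    using a unfolding Delta.in_mball by (auto simp: dist_on_def)
  have "0 \<le> l1_dist a b"
    unfolding l1_dist_def by (intro suminf_nonneg Delta_summable_diff a bD) auto
  then have "l1_dist a b powr (1 / p) < (r powr p) powr (1 / p)" "l1_dist a b powr (1 / q) < (r powr q) powr (1 / q)"
    using ab p q by (auto intro!: powr_less_mono2 simp: s_def)
  then have lt: "max (l1_dist a b powr (1 / p)) (l1_dist a b powr (1 / q)) < r"
    using p q r by (simp add: powr_powr)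
  let ?y = "polar p u b"
  let ?g = "ell_pair p (dual_seq p ?y)"
  have y: "(?y, ?g) \<in> Pi_set (ell p)" by (rule Pi_set_polar[OF p u bD])
  have "Pi_dist (ell p) (x, f) (?y, ?g) < r"
    using le_less_trans[OF Pi_dist_polar_le[OF p q u a bD] lt] unfolding f x .
  then have yU: "(?y, ?g) \<in> U"
    using r y by (intro subsetD[OF r(2)]) (simp only: Pi.in_mball, simp add: dist_on_def)
  have "closure (range (moment lam b)) \<inter> V \<noteq> {}"
    using b(1) V(2) by (simp add: G_D_iff)
  then obtain m where "moment lam b m \<in> V"
    using open_Int_closure_eq_empty[OF V(1)] by (metis Int_commute disjoint_iff rangeE)
  then have "?g ((diag_op lam ^^ m) ?y) \<in> V"
    using numerical_orbit_diag_op[OF p lam y] weight_polar[OF p u bD] by simp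
  then show "\<exists>n. \<exists>(x, f)\<in>U. f ((diag_op lam ^^ n) x) \<in> V"
    using yU by blast
qed

lemma transitive_imp_moment_dense:
  assumes p: "1 < p" and lam: "bdd_above (range (\<lambda>n. cmod (lam n)))"
    and tr: "topologically_numerically_transitive (ell p) (diag_op lam)"
    and V: "open V" "V \<noteq> {}"
  shows "Delta.mtopology closure_of {a \<in> Delta. \<exists>m. moment lam a m \<in> V} = Delta"
proof -
  interpret Pi: Metric_space "Pi_set (ell p)" "dist_on (Pi_set (ell p)) (Pi_dist (ell p))"
    by (rule Metric_space_Pi[OF ell_normed[OF p]])
  have "\<exists>b\<in>{a \<in> Delta. \<exists>m. moment lam a m \<in> V}. b \<in> Delta.mball a r"
    if a: "a \<in> Delta" and r: "r > 0" for a r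
  proof -
    let ?x = "polar p (\<lambda>_. 1) a"
    let ?f = "ell_pair p (dual_seq p ?x)"
    \<comment> \<open>The radius compensates the Lipschitz constant \<open>2 * p\<close>, so the
      weights of all points of this ball lie within \<open>r\<close> of \<open>a\<close>.\<close>
    let ?U = "Pi.mball (?x, ?f) (r / (2 * p))"
    have Pi: "(?x, ?f) \<in> Pi_set (ell p)"
      by (rule Pi_set_polar[OF p _ a]) simp
    have w: "weight p ?x = a"
      by (rule weight_polar[OF p _ a]) simp
    have "openin (Pi_topology (ell p)) ?U"
      by (simp add: Pi_topology_def)
    moreover have "?U \<noteq> {}"
      using Pi r p Pi.centre_in_mball_iff[of "(?x, ?f)" "r / (2 * p)"] by fastforce
    ultimately obtain n y g where y: "(y, g) \<in> ?U" "g ((diag_op lam ^^ n) y) \<in> V"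
      using tr V unfolding topologically_numerically_transitive_def by blast
    then have yPi: "(y, g) \<in> Pi_set (ell p)" and "Pi_dist (ell p) (?x, ?f) (y, g) < r / (2 * p)"
      unfolding Pi.in_mball by (auto simp: dist_on_def)
    then have "nrm (ell p) (?x - y) < r / (2 * p)"
      by (simp add: Pi_dist_def)
    then have "2 * p * nrm (ell p) (?x - y) < r"
      using p by (simp add: field_simps)
    moreover have yD: "weight p y \<in> Delta"
      using yPi Pi_set_ell[OF p] by simp
    ultimately have "l1_dist a (weight p y) < r"
      using weight_Lipschitz[OF p, of ?x y] a w by simp
    moreover have "moment lam (weight p y) n \<in> V"
      using y(2) numerical_orbit_diag_op[OF p lam yPi] by simp
    ultimately show ?thesis
      using a yD unfolding Delta.in_mball by (auto simp: dist_on_def)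
  qed
  then show ?thesis
    unfolding Delta.metric_closure_of by blast
qed

lemma transitive_imp_G_D_dense:
  assumes p: "1 < p" and lam: "bdd_above (range (\<lambda>n. cmod (lam n)))"
    and tr: "topologically_numerically_transitive (ell p) (diag_op lam)"
  shows "Delta.mtopology closure_of G_D lam = Delta"
proof -
  obtain B :: "complex set set" where B: "countable B" "topological_basis B"
    using ex_countable_basis by blast
  define S where "S V = {a \<in> Delta. \<exists>m. moment lam a m \<in> V}" for V
  \<comment> \<open>The empty set is removed from the basis because \<open>S {}\<close> is empty and
    hence not dense. Countability of the basis is what Baire's theorem requires.\<close>
  let ?G = "S ` (B - {{}})"
  have "Delta.mtopology closure_of \<Inter>?G = Delta"
    by (rule Delta.metric_Baire_category[OF Delta_mcomplete])
      (use B in \<open>auto simp: S_def topological_basis_open intro!: openin_moment[OF lam] transitive_imp_moment_dense[OF p lam tr]\<close>)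
  moreover have "\<Inter>?G \<subseteq> G_D lam"
  proof
    fix a assume a: "a \<in> \<Inter>?G"
    have meets: "a \<in> Delta \<and> (\<exists>m. moment lam a m \<in> V)" if "open V" "V \<noteq> {}" for V
    proof -
      obtain z where "z \<in> V" using \<open>V \<noteq> {}\<close> by blast
      then obtain W where "W \<in> B" "z \<in> W" "W \<subseteq> V"
        using topological_basisE[OF B(2) \<open>open V\<close>] by blast
      moreover from this have "a \<in> S W" using a by blast
      ultimately show ?thesis by (auto simp: S_def)
    qed
    have "closure (range (moment lam a)) = UNIV"
    proof (rule ccontr)
      assume "closure (range (moment lam a)) \<noteq> UNIV"
      then have "- closure (range (moment lam a)) \<noteq> {}" by blast
      \<comment> \<open>If the moments were not dense, the complement of their closure would be a
        nonempty open set and so would contain one of them.\<close>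
      then obtain m where "moment lam a m \<notin> closure (range (moment lam a))"
        using meets[of "- closure (range (moment lam a))"] by auto
      then show False
        using closure_subset[of "range (moment lam a)"] by blast
    qed
    then show "a \<in> G_D lam"
      using meets[of UNIV] by (simp add: G_D_iff)
  qed
  ultimately show ?thesis
    using closure_of_mono[of "\<Inter>?G" "G_D lam" Delta.mtopology]
      closure_of_subset_topspace[of Delta.mtopology "G_D lam"] by auto
qed

theorem theorem3p11:
  fixes p :: real and lam :: "nat \<Rightarrow> complex"
  assumes "1 < p"
    and "bdd_above (range (\<lambda>n. cmod (lam n)))"
  shows "(numerically_hypercyclic (ell p) (diag_op lam) \<longleftrightarrow> G_D lam \<noteq> {}) \<and>
    (topologically_numerically_transitive (ell p) (diag_op lam) \<longleftrightarrow>
       Delta_topology closure_of (G_D lam) = Delta)"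
  unfolding Delta_topology_eq
  using numerically_hypercyclic_diag_op_iff[OF assms] G_D_dense_imp_transitive[OF assms]
    transitive_imp_G_D_dense[OF assms] by blast

end
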